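(* Let $r\geq1$ be an odd integer. Suppose that $\alpha$ is an irrational number for which there exists a subsequence $(q_{k_n})_{n\geq1}$ of the denominators of $\alpha$ such that $$q_{k_n}^{r+1}\|q_{k_n}\alpha\|\to\kappa\in\Big(0,\frac{1}{2(r+1)}\Big).$$ Then for almost every $\beta\in(0,1)$ the following holds: if $f:\mathbb{T}\to(0,\infty)$ is a $C^{r-1}$-function such that $D^{r-1}f$ is linear (affine) on each of the intervals $[0,\beta)$ and $[\beta,1)$ with slopes $1-\beta$ and $-\beta$ respectively, then the special flow $T^f$ built over the rotation $Tx=x+\alpha$ on $\mathbb{T}$ and under $f$ is not isomorphic to its inverse.
   Context: $\mathbb{T}=\mathbb{R}/\mathbb{Z}\cong[0,1)$ with Lebesgue measure; $(q_n)$ is the sequence of denominators of the convergents of the continued fraction expansion of $\alpha$; $\|t\|$ is the distance of $t$ to the nearest integer. $D^{j}f$ is the $j$-th derivative ($D^0f=f$; $C^0$ means continuous on the circle). Special flow: for $f^{(k)}(x)=f(x)+\dots+f(T^{k-1}x)$ ($k>0$), $f^{(0)}=0$, $f^{(k)}(x)=-(f(T^kx)+\dots+f(T^{-1}x))$ ($k<0$), $T^f=(T^f_t)_{t\in\mathbb{R}}$ acts on $X^f=\{(x,s):x\in\mathbb{T},\,0\le s<f(x)\}$ (with the restriction of the product of Lebesgue measures, normalized) by $T^f_t(x,u)=(T^nx,u+t-f^{(n)}(x))$, where $n\in\mathbb{Z}$ is unique with $f^{(n)}(x)\le u+t<f^{(n+1)}(x)$. A flow $(T_t)$ is isomorphic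 to its inverse if there is an invertible measure-preserving $S$ with $T_t\circ S=S\circ T_{-t}$ for all $t\in\mathbb{R}$. *)

theory Defs
  imports "HOL-Analysis.Analysis"
begin

section \<open>Continued fraction denominators\<close>

text \<open>Complete quotients, \<open>\<alpha>\<^sub>0 = \<alpha>\<close> and \<open>\<alpha>\<^bsub>n+1\<^esub> = 1 / {\<alpha>\<^sub>n}\<close>. For irrational \<open>\<alpha>\<close>
  the division is never by zero.\<close>

fun complete_quotient :: "real \<Rightarrow> nat \<Rightarrow> real" where
  "complete_quotient \<alpha> 0 = \<alpha>"
| "complete_quotient \<alpha> (Suc n) = 1 / frac (complete_quotient \<alpha> n)"

definition partial_quotient :: "real \<Rightarrow> nat \<Rightarrow> int" where
  "partial_quotient \<alpha> n = \<lfloor>complete_quotient \<alpha> n\<rfloor>"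

fun cf_denom :: "real \<Rightarrow> nat \<Rightarrow> int" where
  "cf_denom \<alpha> 0 = 1"
| "cf_denom \<alpha> (Suc 0) = partial_quotient \<alpha> 1"
| "cf_denom \<alpha> (Suc (Suc n)) =
     partial_quotient \<alpha> (Suc (Suc n)) * cf_denom \<alpha> (Suc n) + cf_denom \<alpha> n"


section \<open>Functions and rotations on the circle\<close>

text \<open>The circle is represented by \<open>[0,1)\<close>; a function on the circle is given by its
  1-periodic lift to the real line, so that regularity at \<open>0\<close> is regularity on the circle.\<close>

definition circle_Ck :: "nat \<Rightarrow> (real \<Rightarrow> real) \<Rightarrow> bool" where
  "circle_Ck m f \<longleftrightarrow>
     (\<forall>x. f (x + 1) = f x) \<and>
     (\<forall>j<m. (deriv ^^ j) f differentiable_on UNIV) \<and>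
     continuous_on UNIV ((deriv ^^ m) f)"

definition affine_with_slope_on :: "real \<Rightarrow> real set \<Rightarrow> (real \<Rightarrow> real) \<Rightarrow> bool" where
  "affine_with_slope_on a I g \<longleftrightarrow> (\<exists>c. \<forall>x\<in>I. g x = a * x + c)"

definition rotation :: "real \<Rightarrow> real \<Rightarrow> real" where
  "rotation \<alpha> x = frac (x + \<alpha>)"

text \<open>The integer iterates of \<open>rotation \<alpha>\<close> on \<open>[0,1)\<close>, in closed form; the lemmas below
  characterise them as iterates.\<close>

definition rotation_iter :: "real \<Rightarrow> int \<Rightarrow> real \<Rightarrow> real" where
  "rotation_iter \<alpha> n x = rotation (of_int n * \<alpha>) x"

lemma rotation_iter_0: "x \<in> {0..<1} \<Longrightarrow> rotation_iter \<alpha> 0 x = x"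
  by (simp add: rotation_iter_def rotation_def frac_eq)

lemma rotation_iter_Suc: "rotation_iter \<alpha> (n + 1) x = rotation \<alpha> (rotation_iter \<alpha> n x)"
proof -
  have "frac (frac (x + of_int n * \<alpha>) + \<alpha>)
      = frac (x + of_int (n + 1) * \<alpha> + of_int (- \<lfloor>x + of_int n * \<alpha>\<rfloor>))"
    by (simp add: frac_def algebra_simps)
  also have "\<dots> = frac (x + of_int (n + 1) * \<alpha>)"
    by (simp add: frac_def)
  finally show ?thesis
    by (simp add: rotation_iter_def rotation_def)
qed


section \<open>Special flows over rotations\<close>

definition birkhoff_sum :: "real \<Rightarrow> (real \<Rightarrow> real) \<Rightarrow> int \<Rightarrow> real \<Rightarrow> real" where
  "birkhoff_sum \<alpha> f k x =
     (if k \<ge> 0 then \<Sum>i\<in>{0..<k}. f (rotation_iter \<alpha> i x)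
      else - (\<Sum>i\<in>{k..<0}. f (rotation_iter \<alpha> i x)))"

definition special_flow_space :: "(real \<Rightarrow> real) \<Rightarrow> (real \<times> real) set" where
  "special_flow_space f = {(x, s). 0 \<le> x \<and> x < 1 \<and> 0 \<le> s \<and> s < f x}"

text \<open>On pairs, \<open>lebesgue\<close> is the (completed) product of the one-dimensional Lebesgue
  measures.\<close>

definition special_flow_measure :: "(real \<Rightarrow> real) \<Rightarrow> (real \<times> real) measure" where
  "special_flow_measure f =
     scale_measure (1 / emeasure lebesgue (special_flow_space f))
       (lebesgue_on (special_flow_space f))"

definition special_flow ::
    "real \<Rightarrow> (real \<Rightarrow> real) \<Rightarrow> real \<Rightarrow> real \<times> real \<Rightarrow> real \<times> real" where
  "special_flow \<alpha> f t = (\<lambda>(x, u).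
     let n = (THE n. birkhoff_sum \<alpha> f n x \<le> u + t \<and> u + t < birkhoff_sum \<alpha> f (n + 1) x)
     in (rotation_iter \<alpha> n x, u + t - birkhoff_sum \<alpha> f n x))"


section \<open>Isomorphism of a flow with its inverse\<close>

text \<open>As usual in ergodic theory, invertibility and equality of maps are understood
  modulo null sets (the exceptional null set may depend on \<open>t\<close>).\<close>

definition measure_preserving_on :: "'a measure \<Rightarrow> ('a \<Rightarrow> 'a) \<Rightarrow> bool" where
  "measure_preserving_on M S \<longleftrightarrow> S \<in> measurable M M \<and> distr M M S = M"

definition invertible_measure_preserving :: "'a measure \<Rightarrow> ('a \<Rightarrow> 'a) \<Rightarrow> bool" where
  "invertible_measure_preserving M S \<longleftrightarrow>
     measure_preserving_on M S \<and>
     (\<exists>S'. measure_preserving_on M S' \<and>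
        (AE x in M. S' (S x) = x) \<and> (AE x in M. S (S' x) = x))"

definition isomorphic_to_inverse :: "'a measure \<Rightarrow> (real \<Rightarrow> 'a \<Rightarrow> 'a) \<Rightarrow> bool" where
  "isomorphic_to_inverse M \<phi> \<longleftrightarrow>
     (\<exists>S. invertible_measure_preserving M S \<and>
        (\<forall>t. AE x in M. \<phi> t (S x) = S (\<phi> (- t) x)))"

end

theory Submission imports Defs begin

text \<open>Put \<open>q = q\<^bsub>k\<^sub>n\<^esub>\<close>, let \<open>p/q\<close> be the convergent with denominator \<open>q\<close>, and let
  \<open>\<delta> = q\<alpha> - p\<close>, of order \<open>q\<^sup>-\<^sup>r\<^sup>-\<^sup>1\<close>. The sum \<open>f\<^sup>(\<^sup>q\<^sup>)\<close> is constant up to \<open>O(q\<^sup>-\<^sup>r)\<close>, since summing \<open>f\<close> over a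
  coset of \<open>(1/q)\<int>\<close> gives a \<open>1/q\<close>-periodic function whose \<open>r\<close>-th derivative is bounded. Hence, if
  \<open>N = iwq\<close> with \<open>w\<close> a small multiple of \<open>q\<^sup>r\<close> and \<open>i\<close> bounded, then \<open>f\<^sup>(\<^sup>N\<^sup>)\<close> differs from a constant \<open>t\<close>
  by a small amount: the flow at time \<open>t\<close> moves a point \<open>(x,u)\<close> only slightly, and essentially in the
  flow direction, by \<open>t - f\<^sup>(\<^sup>N\<^sup>)(x)\<close>.

  If \<open>S\<close> conjugates the flow to its inverse, then approximating \<open>S\<close> by a continuous map shows that for
  most points \<open>(x,u)\<close>, with image \<open>(x',u')\<close>, the displacements of \<open>(x',u')\<close> at time \<open>t\<close> and of \<open>(x,u)\<close>
  at time \<open>-t\<close> are nearly opposite, so that \<open>f\<^sup>(\<^sup>N\<^sup>)(x') + f\<^sup>(\<^sup>-\<^sup>N\<^sup>)(x)\<close> is nearly \<open>0\<close>, for all \<open>i\<close>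
  simultaneously. This sum is \<open>\<Sum>j<iw. f\<^sup>(\<^sup>q\<^sup>)(x' + j\<delta>) - f\<^sup>(\<^sup>q\<^sup>)(x - (j+1)\<delta>)\<close>. Where no breakpoint is met,
  \<open>D\<^sup>r f\<^sup>(\<^sup>q\<^sup>)\<close> is an integer minus \<open>q\<beta>\<close>, and reversing the direction of time changes the sign of an odd
  derivative; so the difference of order \<open>r + 1\<close> in \<open>i\<close> equals \<open>w\<^sup>r\<^sup>+\<^sup>1\<delta>\<^sup>r\<close> times an integer minus \<open>2q\<beta>\<close>.
  For almost every \<open>\<beta>\<close> the number \<open>2q\<beta>\<close> stays away from the integers for infinitely many \<open>n\<close>, and then
  this difference is bounded away from \<open>0\<close>.\<close>

section \<open>Continued fractions\<close>

lemma complete_quotient_irrational: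
  assumes "\<alpha> \<notin> \<rat>"
  shows "complete_quotient \<alpha> n \<notin> \<rat>"
proof (induction n)
  case 0
  show ?case using assms by simp
next
  case (Suc n)
  let ?x = "complete_quotient \<alpha> n"
  show ?case
  proof
    assume "complete_quotient \<alpha> (Suc n) \<in> \<rat>"
    then have "1 / (1 / frac ?x) \<in> \<rat>" unfolding complete_quotient.simps
      by (rule Rats_divide[OF Rats_1])
    then have "frac ?x + of_int \<lfloor>?x\<rfloor> \<in> \<rat>" by (intro Rats_add) auto
    then show False using Suc by (simp add: frac_def)
  qed
qed

lemma frac_complete_quotient:
  assumes "\<alpha> \<notin> \<rat>"
  shows "0 < frac (complete_quotient \<alpha> n)" "frac (complete_quotient \<alpha> n) < 1"
  using complete_quotient_irrational[OF assms, of n] Ints_subset_Rats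
  by (auto simp: frac_gt_0_iff frac_lt_1)

lemma partial_quotient_pos:
  assumes "\<alpha> \<notin> \<rat>"
  shows "1 \<le> partial_quotient \<alpha> (Suc n)"
  using frac_complete_quotient[OF assms, of n] by (simp add: partial_quotient_def)

lemma cf_denom_pos_aux:
  assumes "\<alpha> \<notin> \<rat>"
  shows "1 \<le> cf_denom \<alpha> n \<and> 1 \<le> cf_denom \<alpha> (Suc n)"
proof (induction n)
  case (Suc n)
  then have "1 * 1 \<le> partial_quotient \<alpha> (Suc (Suc n)) * cf_denom \<alpha> (Suc n)"
    using partial_quotient_pos[OF assms, of "Suc n"]
    by (intro mult_mono partial_quotient_pos assms) auto
  then show ?case using Suc by simp
qed (use partial_quotient_pos[OF assms, of 0] in simp)

lemma cf_denom_pos: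
  assumes "\<alpha> \<notin> \<rat>"
  shows "1 \<le> cf_denom \<alpha> n"
  using cf_denom_pos_aux[OF assms] by blast

text \<open>The index starts at 1 because \<open>cf_denom \<alpha> 0\<close> and
  \<open>cf_denom \<alpha> 1\<close> coincide when the first partial quotient is 1.\<close>

lemma cf_denom_strict_mono:
  assumes "\<alpha> \<notin> \<rat>"
  shows "strict_mono (\<lambda>n. cf_denom \<alpha> (Suc n))"
proof (rule strict_monoI_Suc)
  fix n
  have "1 * cf_denom \<alpha> (Suc n) \<le> partial_quotient \<alpha> (Suc (Suc n)) * cf_denom \<alpha> (Suc n)"
    using cf_denom_pos[OF assms, of "Suc n"]
    by (intro mult_right_mono partial_quotient_pos assms) auto
  then show "cf_denom \<alpha> (Suc n) < cf_denom \<alpha> (Suc (Suc n))"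
    using cf_denom_pos[OF assms, of n] by simp
qed

section \<open>Numerators and signed errors of the convergents\<close>

fun cf_num :: "real \<Rightarrow> nat \<Rightarrow> int" where
  "cf_num \<alpha> 0 = partial_quotient \<alpha> 0"
| "cf_num \<alpha> (Suc 0) = partial_quotient \<alpha> 1 * partial_quotient \<alpha> 0 + 1"
| "cf_num \<alpha> (Suc (Suc n)) =
     partial_quotient \<alpha> (Suc (Suc n)) * cf_num \<alpha> (Suc n) + cf_num \<alpha> n"

lemma cf_det: "cf_num \<alpha> (Suc n) * cf_denom \<alpha> n - cf_num \<alpha> n * cf_denom \<alpha> (Suc n) = (-1) ^ n"
  by (induction n) (simp_all add: algebra_simps)

lemma coprime_cf: "coprime (cf_num \<alpha> n) (cf_denom \<alpha> n)"
proof (rule coprimeI)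
  fix d assume "d dvd cf_num \<alpha> n" "d dvd cf_denom \<alpha> n"
  then have "d dvd (-1) ^ n" unfolding cf_det[of \<alpha> n, symmetric] by auto
  then show "is_unit d" by (metis is_unit_power_iff dvd_minus_iff dvd_trans dvd_refl
      minus_one_mult_self one_dvd dvd_triv_left)
qed

definition cf_error :: "real \<Rightarrow> nat \<Rightarrow> real" where
  "cf_error \<alpha> n = of_int (cf_denom \<alpha> n) * \<alpha> - of_int (cf_num \<alpha> n)"

text \<open>The errors obey the recursion of the denominators. By the induction hypothesis
  \<open>cf_error \<alpha> n\<close> is minus
  \<open>complete_quotient \<alpha> (Suc (Suc n))\<close> times
  \<open>cf_error \<alpha> (Suc n)\<close>, so adding the integer part of that quotient leaves minus
  its fractional part.\<close>

lemma cf_error_Suc: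
  assumes "\<alpha> \<notin> \<rat>"
  shows "cf_error \<alpha> (Suc n) = - frac (complete_quotient \<alpha> (Suc n)) * cf_error \<alpha> n"
proof (induction n)
  case 0
  have "complete_quotient \<alpha> (Suc 0) * frac \<alpha> = 1"
    using frac_complete_quotient[OF assms, of 0] by simp
  then show ?case
    by (simp add: cf_error_def frac_def partial_quotient_def algebra_simps)
next
  case (Suc n)
  let ?y = "complete_quotient \<alpha> (Suc n)" and ?z = "complete_quotient \<alpha> (Suc (Suc n))"
  have "?z * frac ?y = 1"
    using frac_complete_quotient[OF assms, of "Suc n"] by simp
  then have "cf_error \<alpha> n = - ?z * cf_error \<alpha> (Suc n)"
    unfolding Suc by (simp del: complete_quotient.simps add: mult.assoc[symmetric])
  moreover have "cf_error \<alpha> (Suc (Suc n)) =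
      of_int (partial_quotient \<alpha> (Suc (Suc n))) * cf_error \<alpha> (Suc n) + cf_error \<alpha> n"
    by (simp add: cf_error_def algebra_simps)
  ultimately show ?case
    by (simp del: complete_quotient.simps add: frac_def partial_quotient_def algebra_simps)
qed

text \<open>Consecutive errors have opposite signs, so the two terms of the determinant identity add
  up in absolute value to 1.\<close>

lemma cf_error_bound:
  assumes "\<alpha> \<notin> \<rat>"
  shows "cf_denom \<alpha> (Suc n) * \<bar>cf_error \<alpha> n\<bar> \<le> 1"
proof -
  let ?q = "real_of_int (cf_denom \<alpha> n)" and ?q' = "real_of_int (cf_denom \<alpha> (Suc n))"
  have "?q' * cf_error \<alpha> n - ?q * cf_error \<alpha> (Suc n)
      = of_int (cf_num \<alpha> (Suc n) * cf_denom \<alpha> n - cf_num \<alpha> n * cf_denom \<alpha> (Suc n))"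
    by (simp add: cf_error_def algebra_simps del: cf_num.simps cf_denom.simps)
  then have "cf_error \<alpha> n * (?q' + ?q * frac (complete_quotient \<alpha> (Suc n))) = (-1) ^ n"
    unfolding cf_det cf_error_Suc[OF assms] by (simp add: algebra_simps)
  then have "\<bar>cf_error \<alpha> n\<bar> * \<bar>?q' + ?q * frac (complete_quotient \<alpha> (Suc n))\<bar> = 1"
    by (metis abs_mult power_abs abs_minus_cancel abs_one power_one)
  moreover have "?q' \<le> \<bar>?q' + ?q * frac (complete_quotient \<alpha> (Suc n))\<bar>"
    using cf_denom_pos[OF assms, of n] cf_denom_pos[OF assms, of "Suc n"] 
      frac_complete_quotient[OF assms, of "Suc n"]
    by (smt (verit) of_int_nonneg mult_nonneg_nonneg)
  ultimately show ?thesis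
    by (metis abs_ge_zero mult.commute mult_left_mono)
qed

lemma infdist_Ints:
  fixes x :: real
  assumes "\<bar>x - of_int p\<bar> \<le> 1 / 2"
  shows "infdist x \<int> = \<bar>x - of_int p\<bar>"
proof (rule antisym)
  show "infdist x \<int> \<le> \<bar>x - of_int p\<bar>"
    using infdist_le[of "of_int p" \<int> x] by (simp add: dist_real_def)
  have "\<bar>x - of_int p\<bar> \<le> dist x (of_int j)" for j
  proof (cases "j = p")
    case False
    then have "1 \<le> \<bar>real_of_int p - real_of_int j\<bar>" by linarith
    then show ?thesis using assms unfolding dist_real_def by linarith
  qed (simp add: dist_real_def)
  then show "\<bar>x - of_int p\<bar> \<le> infdist x \<int>"
    unfolding infdist_def by (auto intro!: cINF_greatest elim: Ints_cases)
qed

text \<open>From index 1 on the next denominator is at least 2, which makes the error at most 1/2.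
  At index 0 the numerator is the floor of \<alpha>, which may fail to be the nearest
  integer.\<close>

lemma infdist_cf:
  assumes "\<alpha> \<notin> \<rat>"
  shows "infdist (of_int (cf_denom \<alpha> (Suc n)) * \<alpha>) \<int> = \<bar>cf_error \<alpha> (Suc n)\<bar>"
proof -
  have "2 \<le> cf_denom \<alpha> (Suc (Suc n))"
    using cf_denom_pos[OF assms, of "Suc n"]
      strict_monoD[OF cf_denom_strict_mono[OF assms], of n "Suc n"] by linarith
  then have "2 * \<bar>cf_error \<alpha> (Suc n)\<bar> \<le> cf_denom \<alpha> (Suc (Suc n)) * \<bar>cf_error \<alpha> (Suc n)\<bar>"
    by (intro mult_right_mono) (auto simp del: cf_denom.simps)
  then have "\<bar>cf_error \<alpha> (Suc n)\<bar> \<le> 1 / 2"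
    using cf_error_bound[OF assms, of "Suc n"] by simp
  then show ?thesis
    unfolding cf_error_def by (rule infdist_Ints)
qed

section \<open>Multiples of almost every number\<close>

lemma integral_cos_int:
  assumes "j \<noteq> 0"
  shows "((\<lambda>x. cos (2 * pi * real_of_int j * x)) has_integral 0) {0..1}"
proof -
  let ?c = "2 * pi * real_of_int j"
  have "((\<lambda>x. cos (?c * x)) has_integral (sin (?c * 1) / ?c - sin (?c * 0) / ?c)) {0..1}"
    using assms
    by (intro fundamental_theorem_of_calculus)
      (auto simp: has_real_derivative_iff_has_vector_derivative[symmetric] intro!: derivative_eq_intros)
  moreover have "sin ?c = 0" 
    using sin_integer_2pi[of "real_of_int j"] by (simp add: mult.commute mult.left_commute)
  ultimately show ?thesis by simp
qed

lemma integral_cos_cos: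
  fixes a b :: int
  assumes "0 < a" "0 < b"
  shows "((\<lambda>x. cos (2 * pi * a * x) * cos (2 * pi * b * x)) has_integral
           (if a = b then 1 / 2 else 0)) {0..1}"
proof -
  have *: "cos (2 * pi * a * x) * cos (2 * pi * b * x)
      = (cos (2 * pi * of_int (a - b) * x) + cos (2 * pi * of_int (a + b) * x)) / 2" for x
    by (simp add: cos_times_cos algebra_simps)
  have "((\<lambda>x. cos (2 * pi * of_int (a - b) * x)) has_integral (if a = b then 1 else 0)) {0..1}"
    using integral_cos_int[of "a - b"] has_integral_const_real[of 1 0 1] by auto
  then have "((\<lambda>x. (cos (2 * pi * of_int (a - b) * x) + cos (2 * pi * of_int (a + b) * x)) / 2)
      has_integral ((if a = b then 1 else 0) + 0) / 2) {0..1}"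
    using assms by (intro has_integral_divide has_integral_add integral_cos_int) auto
  then show ?thesis unfolding * by (simp split: if_splits)
qed

text \<open>A second-moment argument. On \<open>E M\<close> all cosines with index at least
  \<open>M\<close> are at least 1/2, so a sum of \<open>N\<close> of them is at least N/2, while by
  orthogonality its square has integral N/2. Hence \<open>E M\<close> has measure at most 2/N for
  every \<open>N\<close>. The constant 1/6 comes from cos (pi/3) = 1/2.\<close>

lemma AE_frequently_far_from_Ints:
  fixes Q :: "nat \<Rightarrow> int"
  assumes "strict_mono Q" "\<And>n. 0 < Q n"
  shows "AE \<beta> in lebesgue_on {0<..<1::real}. \<exists>\<^sub>F n in sequentially.
           \<forall>N::int. 1 / 6 \<le> \<bar>of_int (Q n) * \<beta> - of_int N\<bar>"
proof -
  let ?c = "\<lambda>n x. cos (2 * pi * of_int (Q n) * x)"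
  define E where "E M = {x \<in> {0..1}. \<forall>n\<ge>M. 1 / 2 \<le> ?c n x}" for M :: nat
  have null: "E M \<in> null_sets lebesgue" for M
  proof -
    have cl: "closed (E M)"
    proof -
      have "E M = {0..1} \<inter> (\<Inter>n\<in>{M..}. {x. 1 / 2 \<le> ?c n x})" by (auto simp: E_def)
      then show ?thesis
        by (auto intro!: closed_INT closed_Int closed_Collect_le continuous_intros)
    qed
    then have meas: "E M \<in> lmeasurable"
      by (intro lmeasurable_compact) (auto simp: compact_eq_bounded_closed E_def 
          intro: bounded_subset[of "{0..1}"])
    have "measure lebesgue (E M) \<le> 2 / real N" if "N > 0" for N
    proof -
      define s where "s x = (\<Sum>n\<in>{M..<M+N}. ?c n x)" for x
      have "((\<lambda>x. \<Sum>i\<in>{M..<M+N}. \<Sum>j\<in>{M..<M+N}. ?c i x * ?c j x) has_integral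
         (\<Sum>i\<in>{M..<M+N}. \<Sum>j\<in>{M..<M+N}. if Q i = Q j then 1 / 2 else 0)) {0..1}"
        by (intro has_integral_sum integral_cos_cos assms finite_atLeastLessThan)
      moreover have "(\<lambda>x. (s x)\<^sup>2) = (\<lambda>x. \<Sum>i\<in>{M..<M+N}. \<Sum>j\<in>{M..<M+N}. ?c i x * ?c j x)"
        by (simp add: s_def power2_eq_square sum_product)
      moreover have "(\<Sum>i\<in>{M..<M+N}. \<Sum>j\<in>{M..<M+N}. if Q i = Q j then 1 / 2 else 0) = real N / 2"
        using strict_mono_eq[OF assms(1)] by simp
      ultimately have s: "((\<lambda>x. (s x)\<^sup>2) has_integral (real N / 2)) {0..1}" by simp
      have "((\<lambda>x. indicat_real (E M) x * (real N / 2)\<^sup>2) has_integral 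
          (measure lebesgue (E M) * (real N / 2)\<^sup>2)) {0..1}"
      proof (intro has_integral_mult_left)
        have "indicat_real (E M) = (\<lambda>x. if x \<in> {0..1} then indicat_real (E M) x else 0)"
          by (auto simp: E_def indicator_def)
        then show "(indicat_real (E M) has_integral measure lebesgue (E M)) {0..1}"
          using meas unfolding lmeasurable_iff_has_integral
          by (metis has_integral_restrict_UNIV)
      qed
      then have "measure lebesgue (E M) * (real N / 2)\<^sup>2 \<le> real N / 2"
      proof (rule has_integral_le[OF _ s])
        fix x :: real
        have "(real N / 2)\<^sup>2 \<le> (s x)\<^sup>2" if "x \<in> E M"
        proof (rule power_mono)
          have "(\<Sum>n\<in>{M..<M+N}. 1 / 2) \<le> s x"
            unfolding s_def using that by (intro sum_mono) (auto simp: E_def)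
          then show "real N / 2 \<le> s x" by simp
        qed simp
        then show "indicat_real (E M) x * (real N / 2)\<^sup>2 \<le> (s x)\<^sup>2"
          by (auto simp: indicator_def)
      qed
      then show ?thesis using that by (simp add: field_simps power2_eq_square)
    qed
    then have "\<forall>\<^sub>F N in sequentially. measure lebesgue (E M) \<le> 2 / real N"
      by (meson eventually_gt_at_top eventually_mono)
    moreover have "(\<lambda>N. 2 / real N) \<longlonglongrightarrow> 0" by real_asymp
    ultimately have "measure lebesgue (E M) \<le> 0"
      by (intro tendsto_lowerbound) auto
    then show ?thesis using meas
      by (simp add: measure_le_0_iff negligible_iff_null_sets[symmetric] negligible_iff_measure0)
  qed
  have "(\<Union>M. E M) \<in> null_sets lebesgue" using null by auto
  then have "AE \<beta> in lebesgue. \<beta> \<notin> (\<Union>M. E M)" by (rule AE_not_in)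
  then have "AE \<beta> in lebesgue_on {0<..<1}. \<beta> \<notin> (\<Union>M. E M)"
    by (simp add: AE_restrict_space_iff) (auto elim: eventually_mono)
  then show ?thesis
    using AE_space
  proof eventually_elim
    case b: (elim \<beta>)
    have "\<exists>\<^sub>F n in sequentially. ?c n \<beta> < 1 / 2"
      using b by (fastforce simp: E_def frequently_sequentially not_le)
    moreover have "1 / 6 \<le> \<bar>of_int (Q n) * \<beta> - of_int N\<bar>" if c: "?c n \<beta> < 1 / 2" for n and N :: int
    proof (rule ccontr)
      assume "\<not> 1 / 6 \<le> \<bar>of_int (Q n) * \<beta> - of_int N\<bar>"
      then have "\<bar>2 * pi * (of_int (Q n) * \<beta> - of_int N)\<bar> \<le> pi / 3"
        by (simp add: abs_mult)
      then have "cos (pi / 3) \<le> cos \<bar>2 * pi * (of_int (Q n) * \<beta> - of_int N)\<bar>"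
        by (intro cos_monotone_0_pi_le) auto
      also have "\<dots> = cos (2 * pi * of_int (Q n) * \<beta> - 2 * pi * of_int N)"
        by (simp add: algebra_simps)
      also have "\<dots> = ?c n \<beta>"
        by (simp add: cos_diff sin_int_2pin cos_int_2pin)
      finally show False using c by (simp add: cos_60)
    qed
    ultimately show ?case
      unfolding frequently_sequentially by meson
  qed
qed

section \<open>Birkhoff sums of periodic functions\<close>

lemma periodic_of_int:
  fixes f :: "real \<Rightarrow> 'a"
  assumes "\<And>x. f (x + 1) = f x"
  shows "f (x + of_int n) = f x"
proof (induction n rule: int_induct[where k = 0])
  case (step1 i)
  then show ?case using assms[of "x + of_int i"] by (simp add: add.assoc)
next
  case (step2 i)
  then show ?case using assms[of "x + of_int (i - 1)"] by (simp add: add.assoc)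
qed simp

lemma periodic_rotation_iter:
  fixes f :: "real \<Rightarrow> real"
  assumes "\<And>x. f (x + 1) = f x"
  shows "f (rotation_iter \<alpha> n x) = f (x + of_int n * \<alpha>)"
  using periodic_of_int[of f, OF assms, of "rotation_iter \<alpha> n x" "\<lfloor>x + of_int n * \<alpha>\<rfloor>"]
  by (simp add: rotation_iter_def rotation_def frac_def)

lemma birkhoff_sum_0 [simp]: "birkhoff_sum \<alpha> f 0 x = 0"
  by (simp add: birkhoff_sum_def)

context
  fixes f :: "real \<Rightarrow> real"
  assumes per: "\<And>x. f (x + 1) = f x"
begin

lemma birkhoff_sum_Suc:
  "birkhoff_sum \<alpha> f (n + 1) x = birkhoff_sum \<alpha> f n x + f (x + of_int n * \<alpha>)"
proof (cases "n \<ge> 0")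
  case True
  then have "{0..<n + 1} = insert n {0..<n}" by auto
  then show ?thesis using True
    by (simp add: birkhoff_sum_def periodic_rotation_iter[of f, OF per])
next
  case False
  then have "{n..<0} = insert n {n + 1..<0}" by auto
  then show ?thesis using False
    by (auto simp: birkhoff_sum_def periodic_rotation_iter[of f, OF per])
qed

lemma birkhoff_sum_add:
  "birkhoff_sum \<alpha> f (m + n) x = birkhoff_sum \<alpha> f m x + birkhoff_sum \<alpha> f n (x + of_int m * \<alpha>)"
proof (induction n rule: int_induct[where k = 0])
  case (step1 i)
  then show ?case
    using birkhoff_sum_Suc[of \<alpha> "m + i" x] birkhoff_sum_Suc[of \<alpha> i "x + of_int m * \<alpha>"]
    by (simp add: algebra_simps)
next
  case (step2 i)
  then show ?case
    using birkhoff_sum_Suc[of \<alpha> "m + i - 1" x] birkhoff_sum_Suc[of \<alpha> "i - 1" "x + of_int m * \<alpha>"]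
    by (simp add: algebra_simps)
qed simp

lemma birkhoff_sum_uminus:
  "birkhoff_sum \<alpha> f (- n) x = - birkhoff_sum \<alpha> f n (x - of_int n * \<alpha>)"
  using birkhoff_sum_add[of \<alpha> "- n" n x] by simp

lemma birkhoff_sum_strict_mono:
  assumes "\<And>x. 0 < f x"
  shows "strict_mono (\<lambda>n. birkhoff_sum \<alpha> f n x)"
proof (rule strict_monoI)
  fix m n :: int assume "m < n"
  then show "birkhoff_sum \<alpha> f m x < birkhoff_sum \<alpha> f n x"
  proof (induction n rule: int_gr_induct)
    case base
    then show ?case using birkhoff_sum_Suc[of \<alpha> m x] assms by simp
  next
    case (step i)
    then show ?case using birkhoff_sum_Suc[of \<alpha> i x] assms[of "x + of_int i * \<alpha>"] by simp
  qed
qed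

lemma continuous_birkhoff_sum:
  assumes "continuous_on UNIV f"
  shows "continuous_on UNIV (birkhoff_sum \<alpha> f n)"
proof -
  have "continuous_on UNIV (\<lambda>x. f (x + of_int i * \<alpha>))" for i
    by (intro continuous_on_compose2[OF assms] continuous_intros) auto
  then show ?thesis
    unfolding birkhoff_sum_def periodic_rotation_iter[of f, OF per]
    by (cases "n \<ge> 0") (auto intro!: continuous_intros)
qed

text \<open>The Birkhoff sums at a fixed point increase strictly with \<open>n\<close>, so the
  description in \<open>special_flow\<close> has a unique solution.\<close>

lemma special_flow_eq:
  assumes "\<And>x. 0 < f x"
    and "0 \<le> u + t - birkhoff_sum \<alpha> f n x"
    and "u + t - birkhoff_sum \<alpha> f n x < f (x + of_int n * \<alpha>)"
  shows "special_flow \<alpha> f t (x, u) = (rotation_iter \<alpha> n x, u + t - birkhoff_sum \<alpha> f n x)"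
proof -
  have "(THE n. birkhoff_sum \<alpha> f n x \<le> u + t \<and> u + t < birkhoff_sum \<alpha> f (n + 1) x) = n"
  proof (rule the_equality)
    show "birkhoff_sum \<alpha> f n x \<le> u + t \<and> u + t < birkhoff_sum \<alpha> f (n + 1) x"
      using assms by (simp add: birkhoff_sum_Suc)
    fix m assume m: "birkhoff_sum \<alpha> f m x \<le> u + t \<and> u + t < birkhoff_sum \<alpha> f (m + 1) x"
    have "birkhoff_sum \<alpha> f m x < birkhoff_sum \<alpha> f (n + 1) x"
      "birkhoff_sum \<alpha> f n x < birkhoff_sum \<alpha> f (m + 1) x"
      using m assms by (simp_all add: birkhoff_sum_Suc)
    then show "m = n"
      unfolding strict_mono_less[OF birkhoff_sum_strict_mono[OF assms(1)]] by simp
  qed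
  then show ?thesis by (simp add: special_flow_def)
qed

end

section \<open>Two facts on Lebesgue measure\<close>

text \<open>By Fubini: each vertical slice of the preimage is a translate of the slice of
  \<open>B\<close> over \<open>x + b\<close>. Later this bounds the set of points that a short
  displacement carries into an exceptional set.\<close>

lemma emeasure_shear:
  fixes a :: "real \<Rightarrow> real" and b :: real
  assumes B [measurable]: "B \<in> sets borel" and a [measurable]: "a \<in> borel_measurable borel"
  shows "(\<lambda>z. (fst z + b, snd z + a (fst z))) -` B \<in> sets borel" (is "?A \<in> _")
    and "emeasure lborel ((\<lambda>z. (fst z + b, snd z + a (fst z))) -` B) = emeasure lborel B"
proof -
  have m: "(\<lambda>z. (fst z + b, snd z + a (fst z))) \<in> borel_measurable (borel :: (real \<times> real) measure)"
    unfolding borel_prod[symmetric] by measurable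
  show A: "?A \<in> sets borel"
    using measurable_sets[OF m B] by simp
  have sets: "A \<in> sets (lborel \<Otimes>\<^sub>M lborel)" if "A \<in> sets borel" for A :: "(real \<times> real) set"
    using that by (metis lborel_prod sets_lborel)
  have trans: "emeasure lborel ((\<lambda>u. u + c) -` C) = emeasure lborel C"
    if "C \<in> sets borel" for C and c :: real
    using that lborel_distr_plus[of c] emeasure_distr[of "(+) c" lborel borel C]
    by (simp add: vimage_def add.commute)
  have slice: "Pair x -` B \<in> sets borel" for x
    using sets_Pair1[OF sets[OF B]] by simp
  have "emeasure lborel ?A = (\<integral>\<^sup>+x. emeasure lborel (Pair x -` ?A) \<partial>lborel)"
    using lborel.emeasure_pair_measure_alt[OF sets[OF A]] by (simp add: lborel_prod)
  also have "\<dots> = (\<integral>\<^sup>+x. emeasure lborel (Pair (x + b) -` B) \<partial>lborel)"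
  proof (rule nn_integral_cong)
    fix x :: real
    have "Pair x -` ?A = (\<lambda>u. u + a x) -` (Pair (x + b) -` B)" by auto
    then show "emeasure lborel (Pair x -` ?A) = emeasure lborel (Pair (x + b) -` B)"
      using trans[OF slice] by simp
  qed
  also have "\<dots> = (\<integral>\<^sup>+x. emeasure lborel (Pair x -` B) \<partial>distr lborel borel ((+) b))"
    by (subst nn_integral_distr)
      (auto simp: add.commute intro!: lborel.measurable_emeasure_Pair[OF sets[OF B], simplified])
  also have "\<dots> = emeasure lborel B"
    using lborel.emeasure_pair_measure_alt[OF sets[OF B]] by (simp add: lborel_prod lborel_distr_plus)
  finally show "emeasure lborel ?A = emeasure lborel B" .
qed

text \<open>A weak form of Lusin's theorem. A measurable function is almost everywhere the limit of
  continuous ones; the sets \<open>D n\<close> where the error still exceeds \<eta> at some index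
  from \<open>n\<close> on decrease to a null set, and \<open>X\<close> has finite measure.\<close>

lemma lebesgue_measurable_near_continuous:
  fixes \<phi> :: "'a::euclidean_space \<Rightarrow> real"
  assumes X: "X \<in> lmeasurable" and \<phi>: "\<phi> \<in> borel_measurable (lebesgue_on X)"
    and "0 < \<eta>" "0 < \<epsilon>"
  obtains g B where "continuous_on UNIV g" "B \<in> sets borel" "emeasure lborel B < \<epsilon>"
    "\<And>z. z \<in> X - B \<Longrightarrow> \<bar>g z - \<phi> z\<bar> \<le> \<eta>"
proof -
  have Xs: "X \<in> sets lebesgue" using X by auto
  obtain Z g where Z: "negligible Z" and g: "\<And>n. continuous_on UNIV (g n)"
    and lim: "\<And>x. x \<notin> Z \<Longrightarrow> (\<lambda>n. g n x) \<longlonglongrightarrow> (if x \<in> X then \<phi> x else 0)"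
    using \<phi> unfolding measurable_on_iff_borel_measurable[OF Xs, symmetric] measurable_on_def
    by blast
  define D where "D n = {z \<in> X. \<exists>k\<ge>n. \<eta> < \<bar>g k z - \<phi> z\<bar>}" for n :: nat
  have D: "D n \<in> sets lebesgue" for n
  proof -
    have gm: "g k \<in> borel_measurable (lebesgue_on X)" for k
      by (meson continuous_imp_measurable_on_sets_lebesgue continuous_on_subset g subset_UNIV Xs)
    have "{z \<in> space (lebesgue_on X). \<exists>k\<in>{n..}. \<eta> < \<bar>g k z - \<phi> z\<bar>} \<in> sets (lebesgue_on X)"
      by (intro sets.sets_Collect_countable_Bex countableI_type borel_measurable_less
          borel_measurable_const borel_measurable_abs borel_measurable_diff \<phi> gm)
    moreover have "D n = {z \<in> space (lebesgue_on X). \<exists>k\<in>{n..}. \<eta> < \<bar>g k z - \<phi> z\<bar>}"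
      by (auto simp: D_def space_restrict_space)
    ultimately show ?thesis
      using Xs sets_restrict_space_iff[of X lebesgue] by auto
  qed
  have "(\<lambda>n. emeasure lebesgue (D n)) \<longlonglongrightarrow> emeasure lebesgue (\<Inter>n. D n)"
  proof (rule Lim_emeasure_decseq)
    show "range D \<subseteq> sets lebesgue" using D by auto
    show "decseq D" by (auto simp: decseq_def D_def intro: order.trans)
    fix n 
    have "emeasure lebesgue (D n) \<le> emeasure lebesgue X"
      using Xs by (intro emeasure_mono) (auto simp: D_def)
    then show "emeasure lebesgue (D n) \<noteq> \<infinity>"
      using fmeasurableD2[OF X] by (auto simp: top_unique)
  qed
  moreover have "(\<Inter>n. D n) \<subseteq> Z"
  proof (rule subsetI, rule ccontr)
    fix z assume z: "z \<in> (\<Inter>n. D n)" "z \<notin> Z"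
    then have "(\<lambda>n. g n z) \<longlonglongrightarrow> \<phi> z" using lim[of z] by (auto simp: D_def)
    then obtain n where "\<forall>k\<ge>n. \<bar>g k z - \<phi> z\<bar> < \<eta>"
      using \<open>0 < \<eta>\<close> by (auto simp: lim_sequentially dist_real_def)
    then show False using z(1) by (fastforce simp: D_def)
  qed
  then have "emeasure lebesgue (\<Inter>n. D n) = 0"
    using Z by (metis negligible_subset negligible_iff_null_sets null_setsD1)
  ultimately have "\<forall>\<^sub>F n in sequentially. emeasure lebesgue (D n) < \<epsilon>"
    using \<open>0 < \<epsilon>\<close> by (simp add: order_tendstoD(2))
  then obtain n where n: "emeasure lebesgue (D n) < \<epsilon>"
    by (auto simp: eventually_sequentially)
  \<comment> \<open>\<open>D n\<close> is only Lebesgue measurable, whereas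
    \<open>emeasure_shear\<close> is applied to Borel sets.\<close>
  obtain B where B: "D n \<subseteq> B" "B \<in> sets lborel" "emeasure lebesgue (D n) = emeasure lborel B"
    using completion_upper[OF D[of n]] by blast
  show thesis
  proof (rule that[of "g n" B])
    fix z assume "z \<in> X - B"
    then have "z \<in> X" "z \<notin> D n" using B(1) by auto
    then show "\<bar>g n z - \<phi> z\<bar> \<le> \<eta>" by (auto simp: D_def not_less)
  qed (use n B g in simp_all)
qed

section \<open>Return times of a reversible special flow\<close>

lemma special_flow_space_lmeasurable:
  fixes f :: "real \<Rightarrow> real"
  assumes cont: "continuous_on UNIV f"
  shows "special_flow_space f \<in> sets borel" "special_flow_space f \<in> lmeasurable"
    "bounded (special_flow_space f)"
proof -
  have [measurable]: "f \<in> borel_measurable borel"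
    using cont by (rule borel_measurable_continuous_onI)
  have "special_flow_space f
      = {z \<in> space (borel \<Otimes>\<^sub>M borel). 0 \<le> fst z \<and> fst z < 1 \<and> 0 \<le> snd z \<and> snd z < f (fst z)}"
    by (auto simp: special_flow_space_def space_pair_measure)
  also have "\<dots> \<in> sets (borel \<Otimes>\<^sub>M borel)" by measurable
  finally show b: "special_flow_space f \<in> sets borel" by (metis borel_prod)
  have "bounded (f ` {0..1})"
    by (intro compact_imp_bounded compact_continuous_image continuous_on_subset[OF cont]) auto
  then obtain F where "\<forall>x\<in>{0..1}. \<bar>f x\<bar> \<le> F"
    unfolding bounded_iff by auto
  then have "special_flow_space f \<subseteq> {0..1} \<times> {0..F}"
    by (force simp: special_flow_space_def)
  then show bd: "bounded (special_flow_space f)"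
    by (rule bounded_subset[rotated]) (intro bounded_Times, auto)
  show "special_flow_space f \<in> lmeasurable"
    using b bd by (simp add: bounded_set_imp_lmeasurable)
qed

lemma emeasure_special_flow_space_pos:
  fixes f :: "real \<Rightarrow> real"
  assumes cont: "continuous_on UNIV f" and pos: "\<And>x. 0 < f x"
  shows "0 < emeasure lebesgue (special_flow_space f)"
proof -
  let ?U = "{z. 0 < fst z \<and> fst z < 1 \<and> 0 < snd z \<and> snd z < f (fst z)}"
  have "open ?U"
    by (intro open_Collect_conj open_Collect_less continuous_intros continuous_on_compose2[OF cont]) auto
  moreover have "(1 / 2, f (1 / 2) / 2) \<in> ?U" using pos[of "1 / 2"] by simp
  then have "?U \<noteq> {}" by blast
  ultimately have "\<not> negligible ?U" by (rule open_not_negligible)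
  moreover have "?U \<subseteq> special_flow_space f" by (auto simp: special_flow_space_def)
  ultimately have "\<not> negligible (special_flow_space f)" using negligible_subset by blast
  then show ?thesis
    using special_flow_space_lmeasurable[OF cont]
    by (auto simp: negligible_iff_emeasure0 zero_less_iff_neq_zero)
qed

text \<open>The margins leave room for a base shift by \<open>e\<close> together with height and
  roof changes of \<open>e\<close> each, or for a purely vertical shift by
  \<open>2 * e\<close>.\<close>

definition flow_interior :: "(real \<Rightarrow> real) \<Rightarrow> real \<Rightarrow> (real \<times> real) set" where
  "flow_interior f e = {(x, u). e < x \<and> x < 1 - e \<and> 2 * e < u \<and> u < f x - 2 * e}"

text \<open>As the margin shrinks, what remains outside decreases to a subset of the two coordinate
  axes.\<close>

lemma flow_interior_exhausts:
  fixes f :: "real \<Rightarrow> real"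
  assumes cont: "continuous_on UNIV f" and "0 < \<epsilon>"
  obtains e where "0 < e" "flow_interior f e \<in> sets borel"
    "emeasure lebesgue (special_flow_space f - flow_interior f e) < \<epsilon>"
proof -
  let ?X = "special_flow_space f"
  define D where "D n = ?X - flow_interior f (1 / real (Suc n))" for n
  have int: "flow_interior f e \<in> sets borel" for e
  proof -
    have "open {z. e < fst z \<and> fst z < 1 - e \<and> 2 * e < snd z \<and> snd z < f (fst z) - 2 * e}"
      by (intro open_Collect_conj open_Collect_less continuous_intros continuous_on_compose2[OF cont]) auto
    moreover have "flow_interior f e
        = {z. e < fst z \<and> fst z < 1 - e \<and> 2 * e < snd z \<and> snd z < f (fst z) - 2 * e}"
      by (auto simp: flow_interior_def)
    ultimately show ?thesis by (simp add: borel_open)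
  qed
  have D: "D n \<in> sets lebesgue" for n
    using int special_flow_space_lmeasurable[OF cont] by (auto simp: D_def)
  have "(\<lambda>n. emeasure lebesgue (D n)) \<longlonglongrightarrow> emeasure lebesgue (\<Inter>n. D n)"
  proof (rule Lim_emeasure_decseq)
    show "range D \<subseteq> sets lebesgue" using D by auto
    have "1 / real (Suc n) \<le> 1 / real (Suc m)" if "m \<le> n" for m n
      using that by (simp add: frac_le)
    then show "decseq D"
      by (fastforce simp: decseq_def D_def flow_interior_def)
    fix n 
    have "emeasure lebesgue (D n) \<le> emeasure lebesgue ?X"
      using special_flow_space_lmeasurable[OF cont] by (intro emeasure_mono) (auto simp: D_def)
    then show "emeasure lebesgue (D n) \<noteq> \<infinity>"
      using fmeasurableD2[OF special_flow_space_lmeasurable(2)[OF cont]] by (auto simp: top_unique)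
  qed
  moreover have "(\<Inter>n. D n) \<subseteq> {0} \<times> UNIV \<union> UNIV \<times> {0}"
  proof (rule subsetI, rule ccontr)
    fix z assume z: "z \<in> (\<Inter>n. D n)" "z \<notin> {0} \<times> UNIV \<union> UNIV \<times> {0}"
    define m where "m = min (min (fst z) (1 - fst z)) (min (snd z) (f (fst z) - snd z) / 2)"
    have "0 < m" using z by (auto simp: m_def D_def special_flow_space_def)
    then obtain n where "1 / real (Suc n) < m"
      using reals_Archimedean by (auto simp: inverse_eq_divide)
    then have "z \<in> flow_interior f (1 / real (Suc n))"
      unfolding m_def by (auto simp: flow_interior_def case_prod_beta)
    then show False using z(1) by (auto simp: D_def)
  qed
  moreover have "{0::real} \<times> (UNIV :: real set) \<union> UNIV \<times> {0} \<in> null_sets lborel"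
  proof (rule null_sets.Un)
    have "emeasure lborel ({0::real} \<times> (UNIV :: real set)) = 0"
      "emeasure lborel ((UNIV :: real set) \<times> {0::real}) = 0"
      unfolding lborel_prod[symmetric] by (simp_all add: lborel.emeasure_pair_measure_Times)
    then show "{0::real} \<times> (UNIV :: real set) \<in> null_sets lborel"
      "(UNIV :: real set) \<times> {0::real} \<in> null_sets lborel"
      by (auto intro!: null_setsI borel_closed closed_Times)
  qed
  then have "negligible ({0::real} \<times> (UNIV :: real set) \<union> UNIV \<times> {0})"
    by (simp only: negligible_iff_null_sets null_sets_completionI)
  ultimately have "(\<lambda>n. emeasure lebesgue (D n)) \<longlonglongrightarrow> 0"
    by (metis negligible_subset negligible_iff_null_sets null_setsD1)
  then have "\<forall>\<^sub>F n in sequentially. emeasure lebesgue (D n) < \<epsilon>"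
    using \<open>0 < \<epsilon>\<close> by (simp add: order_tendstoD(2))
  then obtain n where "emeasure lebesgue (D n) < \<epsilon>"
    by (auto simp: eventually_sequentially)
  then show thesis
    using that[of "1 / real (Suc n)"] int by (simp add: D_def)
qed

text \<open>The normalizing factor is neither 0 nor infinite, so it cancels and the null sets are
  those of Lebesgue measure.\<close>

lemma isomorphic_to_inverse_lebesgue:
  fixes f :: "real \<Rightarrow> real"
  assumes cont: "continuous_on UNIV f" and pos: "\<And>x. 0 < f x"
    and iso: "isomorphic_to_inverse (special_flow_measure f) (special_flow \<alpha> f)"
  obtains S where
    "S \<in> measurable (lebesgue_on (special_flow_space f)) (lebesgue_on (special_flow_space f))"
    "\<And>A. A \<in> sets lebesgue \<Longrightarrow> A \<subseteq> special_flow_space f \<Longrightarrow>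
       emeasure lebesgue (S -` A \<inter> special_flow_space f) = emeasure lebesgue A"
    "\<And>t. AE z in lebesgue_on (special_flow_space f).
       special_flow \<alpha> f t (S z) = S (special_flow \<alpha> f (- t) z)"
proof -
  let ?X = "special_flow_space f"
  let ?c = "1 / emeasure lebesgue ?X"
  note X = special_flow_space_lmeasurable[OF cont]
  have Xs: "?X \<in> sets lebesgue" using X by auto
  have c: "?c \<noteq> 0" "?c \<noteq> top"
    using emeasure_special_flow_space_pos[OF cont pos] fmeasurableD2[OF X(2)]
    by (auto simp: ennreal_divide_eq_top_iff ennreal_divide_eq_0_iff)
  from iso obtain S where S: "invertible_measure_preserving (special_flow_measure f) S"
    and AE: "\<And>t. AE z in special_flow_measure f. special_flow \<alpha> f t (S z) = S (special_flow \<alpha> f (- t) z)"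
    unfolding isomorphic_to_inverse_def by blast
  have m: "S \<in> measurable (special_flow_measure f) (special_flow_measure f)"
    and d: "distr (special_flow_measure f) (special_flow_measure f) S = special_flow_measure f"
    using S by (auto simp: invertible_measure_preserving_def measure_preserving_on_def)
  have sp: "space (special_flow_measure f) = ?X" "sets (special_flow_measure f) = sets (lebesgue_on ?X)"
    by (simp_all add: special_flow_measure_def space_scale_measure space_restrict_space)
  have em: "emeasure (special_flow_measure f) A = ?c * emeasure lebesgue A"
    if "A \<in> sets lebesgue" "A \<subseteq> ?X" for A
    using that Xs by (simp add: special_flow_measure_def emeasure_restrict_space)
  show thesis
  proof (rule that[of S])
    show mS: "S \<in> measurable (lebesgue_on ?X) (lebesgue_on ?X)"
      using m measurable_cong_sets[OF sp(2) sp(2)] by simp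
    fix A assume A: "A \<in> sets lebesgue" "A \<subseteq> ?X"
    have As: "A \<in> sets (special_flow_measure f)"
      using A Xs by (simp add: sp sets_restrict_space_iff)
    have "S -` A \<inter> ?X \<in> sets (lebesgue_on ?X)"
      using measurable_sets[OF m As] by (simp add: sp)
    then have pre: "S -` A \<inter> ?X \<in> sets lebesgue"
      using Xs by (simp add: sets_restrict_space_iff)
    have "?c * emeasure lebesgue A = emeasure (distr (special_flow_measure f) (special_flow_measure f) S) A"
      using em[OF A] d by simp
    also have "\<dots> = ?c * emeasure lebesgue (S -` A \<inter> ?X)"
      unfolding emeasure_distr[OF m As] sp(1) by (rule em[OF pre]) simp
    finally show "emeasure lebesgue (S -` A \<inter> ?X) = emeasure lebesgue A"
      using c by (simp add: ennreal_mult_cancel_left)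
  next
    fix t
    obtain N where N: "N \<in> null_sets (special_flow_measure f)"
      "{z \<in> ?X. special_flow \<alpha> f t (S z) \<noteq> S (special_flow \<alpha> f (- t) z)} \<subseteq> N"
      using AE[of t] unfolding eventually_ae_filter sp(1) by blast
    then have "N \<in> null_sets (lebesgue_on ?X)"
      using c sp(2) unfolding special_flow_measure_def by (auto simp: null_sets_def)
    then show "AE z in lebesgue_on ?X. special_flow \<alpha> f t (S z) = S (special_flow \<alpha> f (- t) z)"
      using N(2) by (intro AE_I'[of N]) (auto simp: space_restrict_space)
  qed
qed

text \<open>A typical \<open>z = (x, u)\<close> is moved in two ways to nearby points: by time
  \<open>- t i\<close> to \<open>p\<close>, and by a short time \<open>s i x\<close> straight up to
  \<open>p'\<close>. The conjugacy gives the heights of \<open>S p\<close> and \<open>S p'\<close>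
  in terms of \<open>S z\<close>, and the continuous approximation \<open>g\<close> of the height of
  \<open>S\<close> forces them to be close. Note the order of the constants: \<open>e\<close>
  precedes \<eta> and \<open>K\<close>, so the time scale can be fixed before the accuracy.\<close>

lemma special_flow_reversal_displacements:
  fixes f :: "real \<Rightarrow> real"
  assumes per: "\<And>x. f (x + 1) = f x" and pos: "\<And>x. 0 < f x"
    and lip: "\<And>x y. \<bar>f x - f y\<bar> \<le> L * \<bar>x - y\<bar>"
    and iso: "isomorphic_to_inverse (special_flow_measure f) (special_flow \<alpha> f)"
  obtains e where "0 < e"
    "\<And>\<eta> K. 0 < \<eta> \<Longrightarrow> \<exists>d>0. \<forall>N t.
       (\<forall>i<K::nat. (\<exists>P::int. \<bar>of_int (N i) * \<alpha> - of_int P\<bar> \<le> d) \<and>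
          (\<forall>x. \<bar>birkhoff_sum \<alpha> f (N i) x - t i\<bar> \<le> e)) \<longrightarrow>
       (\<exists>x x'. \<forall>i<K. \<bar>birkhoff_sum \<alpha> f (N i) x' + birkhoff_sum \<alpha> f (- N i) x\<bar> \<le> \<eta>)"
proof -
  let ?X = "special_flow_space f" and ?bs = "birkhoff_sum \<alpha> f"
  have L: "0 \<le> L" using lip[of 1 0] by simp
  have cont: "continuous_on UNIV f"
    by (rule lipschitz_on_continuous_on[of L]) (auto simp: lipschitz_on_def dist_real_def L lip)
  note X = special_flow_space_lmeasurable[OF cont]
  have Xs: "?X \<in> sets lebesgue" using X by auto
  define V where "V = measure lebesgue ?X"
  have V: "emeasure lebesgue ?X = ennreal V"
    unfolding V_def using X(2) by (simp add: emeasure_eq_measure2)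
  have "0 < V" using emeasure_special_flow_space_pos[OF cont pos] unfolding V by simp
  obtain S where mS: "S \<in> measurable (lebesgue_on ?X) (lebesgue_on ?X)"
    and S_pres: "\<And>A. A \<in> sets lebesgue \<Longrightarrow> A \<subseteq> ?X \<Longrightarrow> emeasure lebesgue (S -` A \<inter> ?X) = emeasure lebesgue A"
    and S_AE: "\<And>t. AE z in lebesgue_on ?X. special_flow \<alpha> f t (S z) = S (special_flow \<alpha> f (- t) z)"
    using isomorphic_to_inverse_lebesgue[OF cont pos iso] by blast
  obtain e where e: "0 < e" "flow_interior f e \<in> sets borel"
    "emeasure lebesgue (?X - flow_interior f e) < ennreal (V / 8)"
    using flow_interior_exhausts[OF cont, of "ennreal (V / 8)"] \<open>0 < V\<close> by auto
  have "\<exists>d>0. \<forall>N t.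
       (\<forall>i<K::nat. (\<exists>P::int. \<bar>of_int (N i) * \<alpha> - of_int P\<bar> \<le> d) \<and> (\<forall>x. \<bar>?bs (N i) x - t i\<bar> \<le> e)) \<longrightarrow>
       (\<exists>x x'. \<forall>i<K. \<bar>?bs (N i) x' + ?bs (- N i) x\<bar> \<le> \<eta>)" if "0 < \<eta>" for \<eta> K
  proof -
    have "snd \<in> borel_measurable (lebesgue_on ?X)"
      using continuous_on_snd[OF continuous_on_id] Xs
      by (rule continuous_imp_measurable_on_sets_lebesgue)
    have "(\<lambda>z. snd (S z)) \<in> borel_measurable (lebesgue_on ?X)"
      by (rule measurable_compose[OF mS \<open>snd \<in> _\<close>])
    \<comment> \<open>Two exceptional sets of this size arise for each of \<open>K\<close> times,
      which costs less than \<open>V / 2\<close> in all; \<open>K + 1\<close> also covers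
      \<open>K = 0\<close>.\<close>
    moreover have "0 < ennreal (V / (4 * real (K + 1)))" using \<open>0 < V\<close> by simp
    ultimately obtain g B where g: "continuous_on UNIV g"
      and B: "B \<in> sets borel" "emeasure lborel B < ennreal (V / (4 * real (K + 1)))"
      and gS: "\<And>z. z \<in> ?X - B \<Longrightarrow> \<bar>g z - snd (S z)\<bar> \<le> \<eta> / 4"
      using lebesgue_measurable_near_continuous[OF X(2), of "\<lambda>z. snd (S z)" "\<eta> / 4"] \<open>0 < \<eta>\<close>
      by (metis divide_pos_pos zero_less_numeral)
    have "compact (closure ?X)" using X by (simp add: compact_closure)
    then have "uniformly_continuous_on (closure ?X) g"
      using g by (meson compact_uniformly_continuous continuous_on_subset subset_UNIV)
    then obtain \<delta> where \<delta>: "0 < \<delta>"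
      "\<And>z z'. z \<in> ?X \<Longrightarrow> z' \<in> ?X \<Longrightarrow> dist z z' < \<delta> \<Longrightarrow> \<bar>g z - g z'\<bar> < \<eta> / 4"
      unfolding uniformly_continuous_on_def dist_real_def using \<open>0 < \<eta>\<close> closure_subset
      by (metis divide_pos_pos subsetD zero_less_numeral)
    \<comment> \<open>The rounding unit: fine enough for the modulus \<delta> of \<open>g\<close>
      and the accuracy \<eta>, and at most \<open>e\<close>, so that a rounded displacement stays
      below \<open>2 * e\<close>.\<close>
    define \<rho> where "\<rho> = min (min (\<delta> / 4) (\<eta> / 4)) e"
    have \<rho>: "0 < \<rho>" "\<rho> \<le> \<delta> / 4" "\<rho> \<le> \<eta> / 4" "\<rho> \<le> e" using \<delta> e \<open>0 < \<eta>\<close> by (auto simp: \<rho>_def)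
    \<comment> \<open>A base shift by \<open>d\<close> stays within the margin and the modulus of
      continuity, and changes the roof by at most \<open>L * d\<close>, hence by at most
      \<open>e\<close>.\<close>
    define d where "d = min (min (\<delta> / 4) e) (e / (L + 1))"
    have d: "0 < d" using \<delta>(1) e(1) L by (simp add: d_def)
    have d': "d \<le> \<delta> / 4" "d \<le> e" unfolding d_def by linarith+
    have "L * d \<le> (L + 1) * (e / (L + 1))" using d L by (intro mult_mono) (auto simp: d_def)
    then have Ld: "L * d \<le> e" using L by simp
    show ?thesis
    proof (rule exI[of _ d], intro conjI allI impI)
      fix N t
      assume Nt: "\<forall>i<K. (\<exists>P::int. \<bar>of_int (N i) * \<alpha> - of_int P\<bar> \<le> d) \<and> (\<forall>x. \<bar>?bs (N i) x - t i\<bar> \<le> e)"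
      then obtain P where P: "\<And>i. i < K \<Longrightarrow> \<bar>of_int (N i) * \<alpha> - of_int (P i)\<bar> \<le> d" by metis
      have bs: "\<bar>?bs (N i) x - t i\<bar> \<le> e" if "i < K" for i x using Nt that by blast
      define b where "b i = of_int (N i) * \<alpha> - of_int (P i)" for i
      define a where "a i x = - t i - ?bs (- N i) x" for i x
      \<comment> \<open>The displacement \<open>a i x\<close> varies continuously with
        \<open>x\<close>, but the conjugacy holds only almost everywhere for each time. Rounding
        leaves countably many times, which share one null set.\<close>
      define s where "s i x = \<rho> * of_int \<lfloor>a i x / \<rho>\<rfloor>" for i x
      have b: "\<bar>b i\<bar> \<le> d" if "i < K" for i using P[OF that] by (simp add: b_def)
      have a: "\<bar>a i x\<bar> \<le> e" if "i < K" for i x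
        using bs[OF that, of "x - of_int (N i) * \<alpha>"]
        by (simp add: a_def birkhoff_sum_uminus[of f, OF per] abs_minus_commute)
      have s: "s i x \<le> a i x" "a i x < s i x + \<rho>" for i x
      proof -
        have "s i x = \<rho> * of_int \<lfloor>a i x / \<rho>\<rfloor>" "a i x = \<rho> * (a i x / \<rho>)" using \<rho> by (auto simp: s_def)
        moreover have "\<rho> * of_int \<lfloor>a i x / \<rho>\<rfloor> \<le> \<rho> * (a i x / \<rho>)" using \<rho> by (intro mult_left_mono) auto
        moreover have "\<rho> * (a i x / \<rho>) < \<rho> * (of_int \<lfloor>a i x / \<rho>\<rfloor> + 1)"
          using \<rho> by (intro mult_strict_left_mono) auto
        ultimately show "s i x \<le> a i x" "a i x < s i x + \<rho>" by (auto simp: algebra_simps)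
      qed
      have a_meas [measurable]: "a i \<in> borel_measurable borel" for i
        unfolding a_def 
        by (intro borel_measurable_continuous_onI continuous_intros continuous_birkhoff_sum[of f, OF per cont])
      have s_meas [measurable]: "s i \<in> borel_measurable borel" for i
        unfolding s_def by measurable
      define C where "C = t ` {..<K} \<union> range (\<lambda>j::int. - \<rho> * of_int j)"
      have "countable C" unfolding C_def by auto
      then have "AE z in lebesgue_on ?X. \<forall>t\<in>C. special_flow \<alpha> f t (S z) = S (special_flow \<alpha> f (- t) z)"
        using S_AE by (intro AE_ball_countable') auto
      then obtain Z where Z: "Z \<in> null_sets (lebesgue_on ?X)"
        "{z \<in> ?X. \<not> (\<forall>t\<in>C. special_flow \<alpha> f t (S z) = S (special_flow \<alpha> f (- t) z))} \<subseteq> Z"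
        unfolding eventually_ae_filter by (auto simp: space_restrict_space)
      \<comment> \<open>\<open>A i\<close> and \<open>A' i\<close> consist of the points whose
        displaced positions \<open>p\<close> and \<open>p'\<close> fall into \<open>B\<close>, where
        \<open>g\<close> is not known to approximate the height of \<open>S\<close>.\<close>
      define A where "A i = (\<lambda>z. (fst z + - b i, snd z + a i (fst z))) -` B" for i
      define A' where "A' i = (\<lambda>z. (fst z + 0, snd z + s i (fst z))) -` B" for i
      have A: "A i \<in> sets lebesgue" "emeasure lebesgue (A i) = emeasure lborel B" for i
        using emeasure_shear[OF B(1) a_meas, of "- b i"] by (auto simp: A_def)
      have A': "A' i \<in> sets lebesgue" "emeasure lebesgue (A' i) = emeasure lborel B" for i
        using emeasure_shear[OF B(1) s_meas, of 0] by (auto simp: A'_def)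
      let ?D = "?X - flow_interior f e"
      \<comment> \<open>The budget: 0 for \<open>Z\<close>, at most \<open>V / 8\<close> each for
        \<open>?D\<close> and its preimage under \<open>S\<close>, and at most \<open>V / 2\<close>
        for the union. The total, at most 3/4 of \<open>V\<close>, leaves a good point
        \<open>z\<close>.\<close>
      let ?bad = "Z \<union> (?D \<union> (S -` ?D \<inter> ?X)) \<union> (\<Union>i<K. A i \<union> A' i)"
      have D: "?D \<in> sets lebesgue" using e Xs by auto
      then have SD: "S -` ?D \<inter> ?X \<in> sets lebesgue"
        using measurable_sets[OF mS, of ?D] Xs
        by (simp add: sets_restrict_space_iff space_restrict_space)
      have Z': "Z \<in> sets lebesgue" "emeasure lebesgue Z = 0"
        using Z(1) Xs by (auto simp: null_sets_def sets_restrict_space_iff emeasure_restrict_space)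
      have "emeasure lebesgue ?bad \<le> emeasure lebesgue (Z \<union> (?D \<union> (S -` ?D \<inter> ?X))) 
            + emeasure lebesgue (\<Union>i<K. A i \<union> A' i)"
        by (intro emeasure_subadditive sets.Un sets.finite_UN A A' D SD Z') auto
      also have "emeasure lebesgue (Z \<union> (?D \<union> (S -` ?D \<inter> ?X)))
          \<le> emeasure lebesgue Z + (emeasure lebesgue ?D + emeasure lebesgue (S -` ?D \<inter> ?X))"
        by (intro order.trans[OF emeasure_subadditive] add_left_mono emeasure_subadditive sets.Un D SD Z')
      also have "\<dots> \<le> ennreal (V / 8) + ennreal (V / 8)"
        unfolding Z'(2) using e(3) S_pres[OF D] by (simp add: add_mono less_imp_le)
      also have "\<dots> = ennreal (V / 4)"
        using \<open>0 < V\<close> by (simp add: ennreal_plus[symmetric] del: ennreal_plus)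
      also have "emeasure lebesgue (\<Union>i<K. A i \<union> A' i) \<le> (\<Sum>i<K. emeasure lebesgue (A i \<union> A' i))"
        using A A' by (intro emeasure_subadditive_finite) auto
      also have "\<dots> \<le> (\<Sum>i<K. ennreal (V / (4 * real (K + 1))) + ennreal (V / (4 * real (K + 1))))"
        using B(2) A A' 
        by (intro sum_mono order.trans[OF emeasure_subadditive] add_mono) auto
      also have "\<dots> = (\<Sum>i<K. ennreal (V / (2 * real (K + 1))))"
      proof -
        have "V / (4 * k) + V / (4 * k) = V / (2 * k)" for k :: real by simp
        moreover have "0 \<le> V / (4 * real (K + 1))" using \<open>0 < V\<close> by simp
        ultimately show ?thesis by (simp only: ennreal_plus[symmetric])
      qed
      also have "\<dots> = ennreal (\<Sum>i<K. V / (2 * real (K + 1)))"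
        using \<open>0 < V\<close> by (intro sum_ennreal) auto
      also have "\<dots> \<le> ennreal (V / 2)"
      proof (intro ennreal_leI)
        have "(\<Sum>i<K. V / (2 * real (K + 1))) = V / 2 * (real K / real (K + 1))" by simp
        also have "\<dots> \<le> V / 2 * 1" using \<open>0 < V\<close> by (intro mult_left_mono) auto
        finally show "(\<Sum>i<K. V / (2 * real (K + 1))) \<le> V / 2" by simp
      qed
      also have "ennreal (V / 4) + ennreal (V / 2) = ennreal (V * 3 / 4)"
        using \<open>0 < V\<close> by (simp add: ennreal_plus[symmetric] del: ennreal_plus)
      also have "\<dots> < emeasure lebesgue ?X"
        unfolding V using \<open>0 < V\<close> by (simp add: ennreal_less_iff)
      finally have "emeasure lebesgue ?bad < emeasure lebesgue ?X" by (simp add: add_mono)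
      then have "\<not> ?X \<subseteq> ?bad"
        using A A' D SD Z' by (metis (no_types, lifting) emeasure_mono leD sets.Un sets.finite_UN finite_lessThan)
      then obtain z where z: "z \<in> ?X" "z \<notin> ?bad" by blast
      obtain x u where xu: "z = (x, u)" by fastforce
      obtain x' u' where xu': "S z = (x', u')" by fastforce
      have "S z \<in> ?X" using measurable_space[OF mS, of z] z(1) by (simp add: space_restrict_space)
      then have int: "(x, u) \<in> flow_interior f e" "(x', u') \<in> flow_interior f e"
        using z xu xu' by auto
      have flow: "special_flow \<alpha> f t (S z) = S (special_flow \<alpha> f (- t) z)" if "t \<in> C" for t
        using Z(2) z that by blast
      show "\<exists>x x'. \<forall>i<K. \<bar>?bs (N i) x' + ?bs (- N i) x\<bar> \<le> \<eta>"
      proof (rule exI[of _ x], rule exI[of _ x'], intro allI impI)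
        fix i assume i: "i < K"
        define h where "h = ?bs (N i) x' - t i"
        have h: "\<bar>h\<bar> \<le> e" using bs[OF i] by (simp add: h_def)
        have shift: "\<bar>f (y + c) - f y\<bar> \<le> e" if "\<bar>c\<bar> \<le> d" for y c
          using lip[of "y + c" y] mult_left_mono[OF that L] Ld by simp
        have fN: "f (y + of_int (N i) * \<alpha>) = f (y + b i)" for y
          using periodic_of_int[of f, OF per, of "y + b i" "P i"] by (simp add: b_def algebra_simps)
        have fN': "f (y - of_int (N i) * \<alpha>) = f (y - b i)" for y
          using periodic_of_int[of f, OF per, of "y - b i" "- P i"] by (simp add: b_def algebra_simps)
        have ins: "x \<in> {0..<1}" "e < x" "x < 1 - e" "2 * e < u" "u < f x - 2 * e"
          "x' \<in> {0..<1}" "2 * e < u'" "u' < f x' - 2 * e"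
          using int e(1) by (auto simp: flow_interior_def)
        have rot: "rotation_iter \<alpha> (- N i) x = x - b i"
        proof -
          have "rotation_iter \<alpha> (- N i) x = frac (x - b i)"
            using periodic_of_int[of frac, OF frac_1_eq, of "x - b i" "- P i"]
            by (simp add: rotation_iter_def rotation_def b_def algebra_simps)
          moreover have "0 \<le> x - b i" "x - b i < 1" using ins b[OF i] d' by linarith+
          ultimately show ?thesis by (simp add: frac_eq)
        qed
        define p where "p = (x - b i, u + a i x)"
        define p' where "p' = (x, u + s i x)"
        have Tmt: "special_flow \<alpha> f (- t i) (x, u) = p"
        proof -
          have "special_flow \<alpha> f (- t i) (x, u)
              = (rotation_iter \<alpha> (- N i) x, u + - t i - ?bs (- N i) x)"
            using ins shift[of "- b i" x] b[OF i] a[OF i, of x]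
            by (intro special_flow_eq[of f, OF per pos]) (auto simp: fN' a_def)
          then show ?thesis by (simp add: rot p_def a_def)
        qed
        have Tt: "snd (special_flow \<alpha> f (t i) (x', u')) = u' - h"
        proof -
          have "special_flow \<alpha> f (t i) (x', u')
              = (rotation_iter \<alpha> (N i) x', u' + t i - ?bs (N i) x')"
            using ins shift[of "b i" x'] b[OF i] h
            by (intro special_flow_eq[of f, OF per pos]) (auto simp: fN h_def)
          then show ?thesis by (simp add: h_def)
        qed
        have short: "special_flow \<alpha> f c (y, v) = (y, v + c)" 
          if "y \<in> {0..<1}" "0 \<le> v + c" "v + c < f y" for y v c
          using special_flow_eq[of f, OF per pos, of v c \<alpha> 0 y] that by (simp add: rotation_iter_0)
        have sb: "\<bar>s i x\<bar> \<le> 2 * e" using a[OF i, of x] s[of i x] \<rho> by auto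
        have "snd (S p) = u' - h"
          using flow[of "t i"] i Tmt Tt by (simp add: C_def xu'[unfolded xu] xu)
        moreover have "snd (S p') = u' - s i x"
        proof -
          have "special_flow \<alpha> f (s i x) (x, u) = p'" "special_flow \<alpha> f (- s i x) (x', u') = (x', u' + - s i x)"
            unfolding p'_def by (rule short; use ins sb in auto)+
          moreover have "- s i x \<in> C" by (auto simp: C_def s_def)
          ultimately have "(x', u' + - s i x) = S p'"
            using flow[of "- s i x"] by (simp add: xu'[unfolded xu] xu)
          then show ?thesis by (metis add_uminus_conv_diff snd_conv)
        qed
        moreover have pX: "p \<in> ?X - B"
        proof -
          have "p \<in> ?X" using ins b[OF i] d' a[OF i, of x] shift[of "- b i" x]
            by (auto simp: p_def special_flow_space_def)
          then show ?thesis using z(2) i by (auto simp: xu p_def A_def)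
        qed
        moreover have p'X: "p' \<in> ?X - B"
        proof -
          have "p' \<in> ?X" using ins sb by (auto simp: p'_def special_flow_space_def)
          then show ?thesis using z(2) i by (auto simp: xu p'_def A'_def)
        qed
        moreover have "\<bar>g p - g p'\<bar> < \<eta> / 4"
        proof -
          have "dist p p' \<le> \<bar>b i\<bar> + \<bar>a i x - s i x\<bar>"
            using sqrt_sum_squares_le_sum_abs[of "b i" "a i x - s i x"]
            by (simp add: p_def p'_def dist_Pair_Pair dist_real_def)
          then have "dist p p' < \<delta>" using b[OF i] s[of i x] d' \<rho> \<delta>(1) by linarith
          then show ?thesis using \<delta>(2)[of p p'] pX p'X by blast
        qed
        \<comment> \<open>Replacing the height of \<open>S\<close> by \<open>g\<close> at
          \<open>p\<close> and at \<open>p'\<close> costs \<eta>/4 each, and passing from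
          \<open>p\<close> to \<open>p'\<close> another \<eta>/4. The last quarter is for undoing
          the rounding.\<close>
        ultimately have "\<bar>h - s i x\<bar> \<le> \<eta> * 3 / 4"
          using gS[OF pX] gS[OF p'X] by linarith
        then have "\<bar>h - a i x\<bar> \<le> \<eta>" using s[of i x] \<rho> by linarith
        then show "\<bar>?bs (N i) x' + ?bs (- N i) x\<bar> \<le> \<eta>" by (simp add: h_def a_def)
      qed
    qed (use d in auto)
  qed
  then show thesis using that e(1) by blast
qed

section \<open>Finite differences\<close>

primrec fdiff :: "nat \<Rightarrow> real \<Rightarrow> (real \<Rightarrow> real) \<Rightarrow> real \<Rightarrow> real" where
  "fdiff 0 w \<phi> = \<phi>"
| "fdiff (Suc k) w \<phi> = (\<lambda>x. fdiff k w \<phi> (x + w) - fdiff k w \<phi> x)"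

lemma fdiff_shift: "fdiff k w (\<lambda>x. \<phi> (x + c)) x = fdiff k w \<phi> (x + c)"
  by (induction k arbitrary: x) (simp_all add: algebra_simps)

lemma fdiff_sum: "fdiff k w (\<lambda>x. \<Sum>j\<in>J. \<phi> j x) x = (\<Sum>j\<in>J. fdiff k w (\<phi> j) x)"
  by (induction k arbitrary: x) (simp_all add: sum_subtractf)

lemma fdiff_Suc_inner: "fdiff (Suc k) w \<phi> x = fdiff k w (\<lambda>x. \<phi> (x + w) - \<phi> x) x"
  by (induction k arbitrary: x) simp_all

lemma fdiff_bound:
  assumes "\<And>i. i \<le> k \<Longrightarrow> \<bar>\<phi> (x + real i * w)\<bar> \<le> \<eta>"
  shows "\<bar>fdiff k w \<phi> x\<bar> \<le> 2 ^ k * \<eta>"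
  using assms
proof (induction k arbitrary: x)
  case 0
  then show ?case using 0[of 0] by simp
next
  case (Suc k)
  have "\<bar>fdiff k w \<phi> x\<bar> \<le> 2 ^ k * \<eta>"
    using Suc.prems by (intro Suc.IH) auto
  moreover have "\<bar>fdiff k w \<phi> (x + w)\<bar> \<le> 2 ^ k * \<eta>"
  proof (rule Suc.IH)
    fix i assume "i \<le> k"
    then show "\<bar>\<phi> (x + w + real i * w)\<bar> \<le> \<eta>"
      using Suc.prems[of "Suc i"] by (simp add: algebra_simps)
  qed
  ultimately show ?case by simp
qed

lemma DERIV_fdiff:
  assumes "\<And>x. (\<phi> has_real_derivative \<psi> x) (at x)"
  shows "(fdiff k w \<phi> has_real_derivative fdiff k w \<psi> x) (at x)"
proof (induction k arbitrary: x)
  case (Suc k)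
  then show ?case
    using Suc[of "x + w"] by (auto intro!: DERIV_diff simp: DERIV_shift)
qed (simp add: assms)

text \<open>The sequence \<phi> is a chain of successive derivatives; each application of the mean
  value theorem trades one difference for a factor \<open>w\<close> and one derivative.\<close>

lemma fdiff_mean_value:
  assumes "0 < w" "\<And>j x. j < k \<Longrightarrow> (\<phi> j has_real_derivative \<phi> (Suc j) x) (at x)"
  shows "\<exists>\<xi>\<in>{x..x + real k * w}. fdiff k w (\<phi> 0) x = w ^ k * \<phi> k \<xi>"
  using assms
proof (induction k arbitrary: x \<phi>)
  case 0
  then show ?case by simp
next
  case (Suc k)
  have "\<exists>z. x < z \<and> z < x + w \<and> fdiff k w (\<phi> 0) (x + w) - fdiff k w (\<phi> 0) x
      = (x + w - x) * fdiff k w (\<phi> (Suc 0)) z"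
    using Suc.prems by (intro MVT2 DERIV_fdiff) auto
  then obtain z where z: "x < z" "z < x + w" "fdiff (Suc k) w (\<phi> 0) x = w * fdiff k w (\<phi> (Suc 0)) z"
    by auto
  obtain \<xi> where "\<xi> \<in> {z..z + real k * w}" "fdiff k w (\<phi> (Suc 0)) z = w ^ k * \<phi> (Suc k) \<xi>"
    using Suc.IH[of "\<lambda>j. \<phi> (Suc j)" z] Suc.prems by auto
  then show ?case using z by (intro bexI[of _ \<xi>]) (auto simp: algebra_simps)
qed

text \<open>One difference is kept for the end: the mean value theorem is applied \<open>k\<close>
  times to the increment of \<phi> over \<open>w\<close>. As the increment of \<phi>
  \<open>k\<close> does not depend on the intermediate point, the result is exact, and \<phi>
  \<open>k\<close> need not be differentiable.\<close>

lemma fdiff_eq_if_affine_derivative: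
  assumes w: "0 < w" and der: "\<And>j x. j < k \<Longrightarrow> (\<phi> j has_real_derivative \<phi> (Suc j) x) (at x)"
    and aff: "\<And>\<xi>. \<xi> \<in> {x..x + real k * w} \<Longrightarrow> \<phi> k (\<xi> + w) - \<phi> k \<xi> = w * v"
  shows "fdiff (Suc k) w (\<phi> 0) x = w ^ Suc k * v"
proof -
  have "((\<lambda>x. \<phi> j (x + w) - \<phi> j x) has_real_derivative \<phi> (Suc j) (x + w) - \<phi> (Suc j) x) (at x)"
    if "j < k" for j x
    using der[OF that] by (auto intro!: DERIV_diff simp: DERIV_shift[symmetric])
  then obtain \<xi> where "\<xi> \<in> {x..x + real k * w}"
    "fdiff k w (\<lambda>x. \<phi> 0 (x + w) - \<phi> 0 x) x = w ^ k * (\<phi> k (\<xi> + w) - \<phi> k \<xi>)"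
    using fdiff_mean_value[OF w, of k "\<lambda>j x. \<phi> j (x + w) - \<phi> j x" x] by auto
  then show ?thesis using aff unfolding fdiff_Suc_inner by simp
qed

section \<open>Oscillation of sums along rational rotations\<close>

text \<open>Periodicity forces the derivative to vanish somewhere, so its oscillation bounds its
  absolute value.\<close>

lemma lipschitz_antiderivative:
  fixes \<phi> \<psi> :: "real \<Rightarrow> real"
  assumes "0 < p" and per: "\<And>x. \<phi> (x + p) = \<phi> x"
    and der: "\<And>x. (\<phi> has_real_derivative \<psi> x) (at x)"
    and osc: "\<And>x y. \<bar>\<psi> x - \<psi> y\<bar> \<le> D"
  shows "\<bar>\<phi> x - \<phi> y\<bar> \<le> D * \<bar>x - y\<bar>"
proof -
  obtain \<xi> where "\<phi> (x + p) - \<phi> x = (x + p - x) * \<psi> \<xi>"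
    using MVT2[of x "x + p" \<phi> \<psi>] der \<open>0 < p\<close> by auto
  then have "\<psi> \<xi> = 0" using per[of x] \<open>0 < p\<close> by simp
  then have bd: "\<bar>\<psi> z\<bar> \<le> D" for z using osc[of z \<xi>] by simp
  have "\<bar>\<phi> x - \<phi> y\<bar> \<le> D * (y - x)" if less: "x < y" for x y
  proof -
    obtain z where "\<phi> y - \<phi> x = (y - x) * \<psi> z"
      using MVT2[OF less, of \<phi> \<psi>] der by auto
    moreover have "\<bar>y - x\<bar> * \<bar>\<psi> z\<bar> \<le> (y - x) * D"
      using that bd[of z] by (intro mult_mono) auto
    ultimately show ?thesis by (simp add: abs_minus_commute[of "\<phi> x"] abs_mult mult.commute)
  qed
  from this[of x y] this[of y x] show ?thesis
    by (cases x y rule: linorder_cases) (auto simp: abs_minus_commute)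
qed

text \<open>One of the two points can be moved by a multiple of the period to within distance
  \<open>p\<close> of the other. With \<open>p = 1 / q\<close> each integration gains a factor
  1/q.\<close>

lemma oscillation_antiderivative:
  fixes \<phi> \<psi> :: "real \<Rightarrow> real"
  assumes "0 < p" and per: "\<And>x. \<phi> (x + p) = \<phi> x"
    and der: "\<And>x. (\<phi> has_real_derivative \<psi> x) (at x)"
    and osc: "\<And>x y. \<bar>\<psi> x - \<psi> y\<bar> \<le> D"
  shows "\<bar>\<phi> x - \<phi> y\<bar> \<le> D * p"
proof -
  define y' where "y' = x + p * frac ((y - x) / p)"
  have "\<phi> (p * (z + 1)) = \<phi> (p * z)" for z
    using per[of "p * z"] by (simp add: algebra_simps)
  then have "\<phi> (p * (z + of_int n)) = \<phi> (p * z)" for z n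
    using periodic_of_int[of "\<lambda>z. \<phi> (p * z)"] by blast
  from this[of "y' / p" "\<lfloor>(y - x) / p\<rfloor>"] have "\<phi> (y' + p * of_int \<lfloor>(y - x) / p\<rfloor>) = \<phi> y'"
    using \<open>0 < p\<close> by (simp add: distrib_left)
  moreover have "y' + p * of_int \<lfloor>(y - x) / p\<rfloor> = x + p * ((y - x) / p)"
    by (simp add: y'_def frac_def algebra_simps)
  ultimately have "\<phi> y = \<phi> y'" using \<open>0 < p\<close> by simp
  moreover have y': "x \<le> y'" "y' < x + p"
    using \<open>0 < p\<close> frac_lt_1[of "(y - x) / p"] mult_strict_left_mono[OF frac_lt_1[of "(y - x) / p"] \<open>0 < p\<close>]
    by (auto simp: y'_def)
  have "D * \<bar>y' - x\<bar> \<le> D * p" using y' osc[of 0 0] by (intro mult_left_mono) auto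
  then have "\<bar>\<phi> y' - \<phi> x\<bar> \<le> D * p"
    using lipschitz_antiderivative[OF \<open>0 < p\<close> per der osc, of y' x] by linarith
  ultimately show ?thesis by (simp add: abs_minus_commute)
qed

text \<open>Up to an additive constant, \<open>D\<^sup>r\<^sup>-\<^sup>1 f\<close> is this function.\<close>

definition tent :: "real \<Rightarrow> real \<Rightarrow> real" where
  "tent \<beta> x = min (frac x) \<beta> - \<beta> * frac x"

text \<open>Both slopes have absolute value below 1. When an integer lies between the points, the
  path is split there, where \<open>tent\<close> vanishes.\<close>

lemma tent_lipschitz:
  assumes "0 < \<beta>" "\<beta> < 1"
  shows "\<bar>tent \<beta> x - tent \<beta> y\<bar> \<le> \<bar>x - y\<bar>"
proof -
  have core: "\<bar>(min s \<beta> - \<beta> * s) - (min t \<beta> - \<beta> * t)\<bar> \<le> t - s" if "s \<le> t" for s t :: real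
  proof -
    have "\<beta> * s \<le> \<beta> * t" "\<beta> * (t - s) \<le> 1 * (t - s)"
      using that assms by (intro mult_left_mono mult_right_mono; simp)+
    then show ?thesis using that by (auto simp: min_def algebra_simps abs_le_iff)
  qed
  have zero: "tent \<beta> (of_int n) = 0" for n using assms by (simp add: tent_def)
  have lt: "\<bar>tent \<beta> x - tent \<beta> y\<bar> \<le> y - x" if "x \<le> y" for x y
  proof (cases "\<lfloor>x\<rfloor> = \<lfloor>y\<rfloor>")
    case True
    then show ?thesis using core[of "frac x" "frac y"] that by (simp add: tent_def frac_def)
  next
    case False
    then have fl: "\<lfloor>x\<rfloor> + 1 \<le> \<lfloor>y\<rfloor>" using floor_mono[OF that] by linarith
    have "\<bar>tent \<beta> x\<bar> \<le> 1 - frac x"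
      using core[of "frac x" 1] frac_lt_1[of x] assms by (simp add: tent_def)
    moreover have "\<bar>tent \<beta> y\<bar> \<le> frac y"
      using core[of 0 "frac y"] assms by (simp add: tent_def)
    ultimately show ?thesis using fl unfolding frac_def by linarith
  qed
  show ?thesis using lt[of x y] lt[of y x] by (cases "x \<le> y") (auto simp: abs_minus_commute)
qed

text \<open>The difference of floors is 1 to the left of \<beta> and 0 to its right. In this form
  the slope is constant wherever neither \<open>x\<close> nor \<open>x - \<beta>\<close> crosses an
  integer.\<close>

lemma tent_affine:
  assumes "0 < \<beta>" "\<beta> < 1" "\<lfloor>x\<rfloor> = \<lfloor>y\<rfloor>" "\<lfloor>x - \<beta>\<rfloor> = \<lfloor>y - \<beta>\<rfloor>"
  shows "tent \<beta> y - tent \<beta> x = (of_int (\<lfloor>x\<rfloor> - \<lfloor>x - \<beta>\<rfloor>) - \<beta>) * (y - x)"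
proof -
  have fl: "\<lfloor>z\<rfloor> - \<lfloor>z - \<beta>\<rfloor> = (if frac z < \<beta> then 1 else 0)" for z
  proof -
    have "\<lfloor>z - \<beta>\<rfloor> = (if frac z < \<beta> then \<lfloor>z\<rfloor> - 1 else \<lfloor>z\<rfloor>)"
      using assms(1,2) frac_lt_1[of z] frac_ge_0[of z] unfolding frac_def
      by (intro floor_unique) (auto; linarith)+
    then show ?thesis by simp
  qed
  consider "frac x < \<beta>" "frac y < \<beta>" "\<lfloor>x\<rfloor> - \<lfloor>x - \<beta>\<rfloor> = 1"
    | "\<beta> \<le> frac x" "\<beta> \<le> frac y" "\<lfloor>x\<rfloor> - \<lfloor>x - \<beta>\<rfloor> = 0"
    using fl[of x] fl[of y] assms(3,4) by (auto split: if_splits)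
  then show ?thesis
    using assms(3) by cases (auto simp: tent_def frac_def algebra_simps)
qed

lemma lattice_sum_periodic:
  fixes F :: "real \<Rightarrow> real" and q :: int
  assumes per: "\<And>x. F (x + 1) = F x" and q: "1 \<le> q"
  shows "(\<Sum>i\<in>{0..<q}. F (x + 1 / of_int q + of_int i / of_int q)) =
         (\<Sum>i\<in>{0..<q}. F (x + of_int i / of_int q))"
proof -
  let ?G = "\<lambda>i::int. F (x + of_int i / of_int q)"
  have "(\<Sum>i\<in>{0..<q}. F (x + 1 / of_int q + of_int i / of_int q)) = (\<Sum>i\<in>{1..<q+1}. ?G i)"
    using q by (intro sum.reindex_bij_witness[of _ "\<lambda>i. i - 1" "\<lambda>i. i + 1"])
      (auto simp: add_divide_distrib algebra_simps)
  moreover have "insert 0 {1..<q+1} = insert q {0..<q}" using q by auto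
  then have "(\<Sum>i\<in>insert 0 {1..<q+1}. ?G i) = (\<Sum>i\<in>insert q {0..<q}. ?G i)" by simp
  then have "?G 0 + (\<Sum>i\<in>{1..<q+1}. ?G i) = ?G q + (\<Sum>i\<in>{0..<q}. ?G i)" by simp
  moreover have "?G q = ?G 0" using q per[of x] by simp
  ultimately show ?thesis by simp
qed

text \<open>The sum has period 1/q, so one cell suffices. For \<open>0 \<le> x < 1 / q\<close> no
  lattice point wraps around, and only the one with index \<open>N\<close>, the floor of q\<beta>,
  can meet \<beta>. Hence the change from 0 to \<open>x\<close> lies between (N - q\<beta>)x and (N
  + 1 - q\<beta>)x, so it is at most \<open>x\<close> in absolute value.\<close>

lemma tent_sum_oscillation:
  fixes q :: int
  assumes \<beta>: "0 < \<beta>" "\<beta> < 1" and q: "1 \<le> q"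
  shows "\<bar>(\<Sum>i\<in>{0..<q}. tent \<beta> (x + of_int i / of_int q)) -
          (\<Sum>i\<in>{0..<q}. tent \<beta> (y + of_int i / of_int q))\<bar> \<le> 2 / of_int q"
proof -
  define P where "P x = (\<Sum>i\<in>{0..<q}. tent \<beta> (x + of_int i / of_int q))" for x
  have q': "0 < real_of_int q" using q by simp
  have per: "P (x + 1 / of_int q) = P x" for x
    unfolding P_def by (rule lattice_sum_periodic[of "tent \<beta>"]) (use q in \<open>auto simp: tent_def frac_1_eq\<close>)
  have cell: "\<bar>P x - P 0\<bar> \<le> 1 / of_int q" if x: "0 \<le> x" "x < 1 / of_int q" for x
  proof -
    define N where "N = \<lfloor>of_int q * \<beta>\<rfloor>"
    have N: "0 \<le> N" "of_int N \<le> of_int q * \<beta>" "of_int q * \<beta> < of_int N + 1"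
      using q' \<beta> by (simp_all add: N_def)
    have "of_int q * \<beta> < of_int q * 1" using q' \<beta> by (intro mult_strict_left_mono) auto
    then have Nq: "N < q" using N by linarith
    define d where "d i = min (x + of_int i / of_int q) \<beta> - min (of_int i / of_int q) \<beta>" for i :: int
    have x1: "x * of_int q < 1" using x q' by (simp add: field_simps)
    have fr: "frac (z + of_int i / of_int q) = z + of_int i / of_int q"
      if "i \<in> {0..<q}" "0 \<le> z" "z < 1 / of_int q" for z :: real and i :: int
    proof -
      have "of_int i + 1 \<le> real_of_int q" using that by (simp add: int_le_real_less)
      then have "(of_int i + 1) / of_int q \<le> (1::real)" using q' by simp
      then show ?thesis using that q' by (simp add: frac_eq add_divide_distrib)
    qed
    have "P x - P 0 = (\<Sum>i\<in>{0..<q}. d i - \<beta> * x)"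
      unfolding P_def sum_subtractf[symmetric]
    proof (rule sum.cong)
      fix i assume i: "i \<in> {0..<q}"
      have "frac (of_int i / of_int q) = (of_int i / of_int q :: real)" using fr[OF i, of 0] q' by simp
      then show "tent \<beta> (x + of_int i / of_int q) - tent \<beta> (0 + of_int i / of_int q) = d i - \<beta> * x"
        using fr[OF i x] by (simp add: tent_def d_def algebra_simps)
    qed simp
    also have "\<dots> = (\<Sum>i\<in>{0..<q}. d i) - of_int q * \<beta> * x"
      using q by (simp add: sum_subtractf)
    finally have eq: "P x - P 0 = (\<Sum>i\<in>{0..<q}. d i) - of_int q * \<beta> * x" .
    have d: "(if i < N then x else 0) \<le> d i" "d i \<le> (if i \<le> N then x else 0)" for i
    proof -
      have "x + of_int i / of_int q \<le> \<beta>" if "i < N"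
      proof -
        have "x * of_int q + of_int i \<le> of_int q * \<beta>" using that N x1 by linarith
        then show ?thesis using q' by (simp add: field_simps)
      qed
      moreover have "\<beta> \<le> of_int i / of_int q" if "N < i"
      proof -
        have "of_int q * \<beta> \<le> of_int i" using that N by linarith
        then show ?thesis using q' by (simp add: field_simps)
      qed
      ultimately show "(if i < N then x else 0) \<le> d i" "d i \<le> (if i \<le> N then x else 0)"
        using x(1) by (auto simp: d_def min_def not_less)
    qed
    have "(\<Sum>i\<in>{0..<q}. if i < N then x else 0) = of_int N * x"
    proof -
      have "{0..<q} \<inter> {i. i < N} = {0..<N}" using Nq by auto
      then show ?thesis using N by (simp add: sum.If_cases)
    qed
    moreover have "(\<Sum>i\<in>{0..<q}. if i \<le> N then x else 0) = (of_int N + 1) * x"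
    proof -
      have "{0..<q} \<inter> {i. i \<le> N} = {0..<N+1}" using Nq by auto
      then show ?thesis using N by (simp add: sum.If_cases)
    qed
    moreover have "(\<Sum>i\<in>{0..<q}. if i < N then x else 0) \<le> (\<Sum>i\<in>{0..<q}. d i)"
      "(\<Sum>i\<in>{0..<q}. d i) \<le> (\<Sum>i\<in>{0..<q}. if i \<le> N then x else 0)"
      using d by (auto intro: sum_mono)
    moreover have "of_int N * x \<le> of_int q * \<beta> * x" "of_int q * \<beta> * x \<le> (of_int N + 1) * x"
      using N x by (auto intro!: mult_right_mono)
    ultimately have "\<bar>P x - P 0\<bar> \<le> x" unfolding eq by (simp add: algebra_simps)
    then show ?thesis using x by simp
  qed
  have "\<bar>P x - P 0\<bar> \<le> 1 / of_int q" for x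
  proof -
    have "P ((z + 1) / of_int q) = P (z / of_int q)" for z
      using per[of "z / of_int q"] by (simp add: add_divide_distrib)
    then have "P ((z + of_int n) / of_int q) = P (z / of_int q)" for z n
      using periodic_of_int[of "\<lambda>z. P (z / of_int q)"] by blast
    from this[of "frac (x * of_int q)" "\<lfloor>x * of_int q\<rfloor>"]
    have "P x = P (frac (x * of_int q) / of_int q)" using q' by (simp add: frac_def)
    then show ?thesis
      using cell[of "frac (x * of_int q) / of_int q"] divide_strict_right_mono[OF frac_lt_1 q', of "x * of_int q"]
        q' by simp
  qed
  from this[of x] this[of y] show ?thesis unfolding P_def by linarith
qed

section \<open>Breakpoints along an orbit\<close>

text \<open>Subtracting the two visits and multiplying by \<open>q\<close> shows that the integer
  \<open>q * (z - z') - (i - i') * p\<close> is smaller than 1 in absolute value, hence 0.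
  Coprimality then gives \<open>i = i'\<close>. The summand 1 in the smallness condition pays for
  the term (i - i')\<delta>.\<close>

lemma approximate_rotation_visits_once:
  fixes \<alpha> \<delta> x \<tau> \<tau>' :: real and p q i i' z z' :: int
  assumes q: "1 \<le> q" and cop: "coprime p q" and \<delta>: "of_int q * \<alpha> = of_int p + \<delta>" "\<delta> \<noteq> 0"
    and i: "i \<in> {0..<q}" "i' \<in> {0..<q}"
    and small: "of_int q * ((\<bar>\<tau> - \<tau>'\<bar> + 1) * \<bar>\<delta>\<bar>) < 1"
    and z: "x + of_int i * \<alpha> + \<tau> * \<delta> = of_int z" "x + of_int i' * \<alpha> + \<tau>' * \<delta> = of_int z'"
  shows "\<tau> = \<tau>'"
proof -
  have q': "1 \<le> real_of_int q" using q by simp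
  have sub: "of_int (i - i') * \<alpha> + (\<tau> - \<tau>') * \<delta> = of_int (z - z')"
    using z by (simp add: algebra_simps)
  have "of_int (i - i') * (of_int q * \<alpha>) + of_int q * ((\<tau> - \<tau>') * \<delta>) = of_int q * of_int (z - z')"
    unfolding sub[symmetric] by (simp add: algebra_simps)
  then have "of_int (q * (z - z') - (i - i') * p) = of_int (i - i') * \<delta> + of_int q * ((\<tau> - \<tau>') * \<delta>)"
    unfolding \<delta> by (simp add: algebra_simps)
  moreover have "\<bar>of_int (i - i') * \<delta>\<bar> \<le> of_int q * \<bar>\<delta>\<bar>"
    unfolding abs_mult using i by (intro mult_right_mono) auto
  moreover have "\<bar>of_int q * ((\<tau> - \<tau>') * \<delta>)\<bar> = of_int q * (\<bar>\<tau> - \<tau>'\<bar> * \<bar>\<delta>\<bar>)"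
    using q by (simp add: abs_mult)
  ultimately have "\<bar>real_of_int (q * (z - z') - (i - i') * p)\<bar> < 1"
    using small by (simp add: algebra_simps)
  then have eq: "q * (z - z') = (i - i') * p" by linarith
  then have "q dvd (i - i') * p" by (metis dvd_triv_left)
  then have "q dvd i - i'" using cop by (simp add: coprime_commute coprime_dvd_mult_left_iff)
  moreover have "\<bar>i - i'\<bar> < q" using i by auto
  ultimately have "i = i'" using zdvd_imp_le[of q "\<bar>i - i'\<bar>"] by fastforce
  then have "z = z'" using eq q by simp
  then show ?thesis using sub \<open>i = i'\<close> \<delta> by simp
qed

text \<open>If the floor took two values, the larger one would be attained as a value on the segment
  in between.\<close>

lemma floor_constant_on_line:
  fixes y c \<tau> \<tau>' :: real
  assumes "\<And>\<sigma>. \<sigma> \<in> {m0..m1} \<Longrightarrow> y + \<sigma> * c \<notin> \<int>" "\<tau> \<in> {m0..m1}" "\<tau>' \<in> {m0..m1}"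
  shows "\<lfloor>y + \<tau> * c\<rfloor> = \<lfloor>y + \<tau>' * c\<rfloor>"
proof -
  have "\<not> \<lfloor>y + \<tau> * c\<rfloor> < \<lfloor>y + \<tau>' * c\<rfloor>" if t: "\<tau> \<in> {m0..m1}" "\<tau>' \<in> {m0..m1}" for \<tau> \<tau>'
  proof
    assume lt: "\<lfloor>y + \<tau> * c\<rfloor> < \<lfloor>y + \<tau>' * c\<rfloor>"
    define B where "B = real_of_int \<lfloor>y + \<tau>' * c\<rfloor>"
    have B: "y + \<tau> * c < B" "B \<le> y + \<tau>' * c" using lt unfolding B_def by linarith+
    define \<theta> where "\<theta> = (B - (y + \<tau> * c)) / ((\<tau>' - \<tau>) * c)"
    have pos: "0 < (\<tau>' - \<tau>) * c" using B by (simp add: algebra_simps)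
    have \<theta>: "0 \<le> \<theta>" "\<theta> \<le> 1" using B pos by (auto simp: \<theta>_def divide_le_eq algebra_simps)
    have "(1 - \<theta>) *\<^sub>R \<tau> + \<theta> *\<^sub>R \<tau>' \<in> {m0..m1}"
      using t \<theta> by (intro convexD_alt[OF convex_real_interval(5)])
    moreover have "y + ((1 - \<theta>) * \<tau> + \<theta> * \<tau>') * c = y + \<tau> * c + \<theta> * ((\<tau>' - \<tau>) * c)"
      by (simp add: algebra_simps)
    moreover have "\<theta> * ((\<tau>' - \<tau>) * c) = B - (y + \<tau> * c)"
      unfolding \<theta>_def by (rule nonzero_eq_divide_eq[THEN iffD1, OF _ refl]) (use pos in linarith)
    ultimately show False using assms(1)[of "(1 - \<theta>) * \<tau> + \<theta> * \<tau>'"] by (simp add: B_def)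
  qed
  from this[OF assms(2,3)] this[OF assms(3,2)] show ?thesis by simp
qed

text \<open>Four families of breakpoints each spoil at most one of five disjoint blocks.\<close>

lemma exists_block_without_breakpoints:
  fixes q p :: int and \<alpha> \<delta> M h :: real and y c :: "nat \<Rightarrow> real"
  assumes q: "1 \<le> q" and cop: "coprime p q" and \<delta>: "of_int q * \<alpha> = of_int p + \<delta>" "\<delta> \<noteq> 0"
    and M: "0 \<le> h" "h < M" and small: "of_int q * ((5 * M + 1) * \<bar>\<delta>\<bar>) < 1"
    and c: "\<And>v. v < 4 \<Longrightarrow> c v = \<delta> \<or> c v = - \<delta>"
  obtains l :: nat where "l < 5"
    "\<And>v i \<tau>. v < 4 \<Longrightarrow> i \<in> {0..<q} \<Longrightarrow> \<tau> \<in> {real l * M..real l * M + h} \<Longrightarrow>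
       y v + of_int i * \<alpha> + \<tau> * c v \<notin> \<int>"
proof -
  define hit where "hit v = {l::nat. l < 5 \<and> (\<exists>i\<in>{0..<q}. \<exists>\<tau>\<in>{real l * M..real l * M + h}.
      y v + of_int i * \<alpha> + \<tau> * c v \<in> \<int>)}" for v
  have fin: "finite (hit v)" for v by (rule finite_subset[of _ "{..<5}"]) (auto simp: hit_def)
  have "card (hit v) \<le> 1" if v: "v < 4" for v
  proof -
    have "l = l'" if l: "l \<in> hit v" "l' \<in> hit v" for l l'
    proof -
      obtain i \<tau> i' \<tau>' where *: "l < 5" "l' < 5" "i \<in> {0..<q}" "i' \<in> {0..<q}"
        "\<tau> \<in> {real l * M..real l * M + h}" "\<tau>' \<in> {real l' * M..real l' * M + h}"
        "y v + of_int i * \<alpha> + \<tau> * c v \<in> \<int>" "y v + of_int i' * \<alpha> + \<tau>' * c v \<in> \<int>"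
        using l unfolding hit_def by blast
      have bounds: "real k * M \<le> 4 * M" if "k < 5" for k :: nat
        using that M by (intro mult_right_mono) auto
      have "0 \<le> real l * M" "0 \<le> real l' * M" using M by auto
      then have "\<bar>\<tau> - \<tau>'\<bar> \<le> 5 * M" using bounds[OF *(1)] bounds[OF *(2)] *(5,6) M
        unfolding abs_le_iff atLeastAtMost_iff by linarith
      then have "of_int q * ((\<bar>\<tau> - \<tau>'\<bar> + 1) * \<bar>\<delta>\<bar>) \<le> of_int q * ((5 * M + 1) * \<bar>\<delta>\<bar>)"
        using q by (intro mult_left_mono mult_right_mono) auto
      then have sm: "of_int q * ((\<bar>\<tau> - \<tau>'\<bar> + 1) * \<bar>\<delta>\<bar>) < 1" using small by linarith
      have sm': "of_int q * ((\<bar>- \<tau> - - \<tau>'\<bar> + 1) * \<bar>\<delta>\<bar>) < 1"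
        using sm by (simp add: abs_minus_commute)
      obtain z z' where zz: "y v + of_int i * \<alpha> + \<tau> * c v = of_int z" "y v + of_int i' * \<alpha> + \<tau>' * c v = of_int z'"
        using *(7,8) by (auto elim!: Ints_cases)
      have "\<tau> = \<tau>'"
        using c[OF v]
      proof
        assume "c v = \<delta>"
        then show ?thesis
          using approximate_rotation_visits_once[OF q cop \<delta> *(3,4) sm, of "y v" z z'] zz by simp
      next
        assume "c v = - \<delta>"
        then have "- \<tau> = - \<tau>'"
          using zz by (intro approximate_rotation_visits_once[OF q cop \<delta> *(3,4) sm', of "y v" z z']) simp_all
        then show ?thesis by simp
      qed
      \<comment> \<open>Both blocks contain the common time, and blocks with different indices are
        disjoint because \<open>h < M\<close>.\<close>
      then have "real l * M < (real l' + 1) * M" "real l' * M < (real l + 1) * M"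
        using * M by (auto simp: algebra_simps)
      then have "real l < real l' + 1" "real l' < real l + 1" using M by (auto simp: mult_less_cancel_right)
      then show ?thesis by linarith
    qed
    then show ?thesis using fin[of v] by (auto simp: card_le_Suc0_iff_eq)
  qed
  then have "(\<Sum>v<4. card (hit v)) \<le> (\<Sum>v<(4::nat). 1)" by (intro sum_mono) auto
  moreover have "card (\<Union>v<4. hit v) \<le> (\<Sum>v<4. card (hit v))" by (rule card_UN_le) simp
  ultimately have "card (\<Union>v<4. hit v) \<noteq> card {..<5::nat}" by simp
  then have "(\<Union>v<4. hit v) \<noteq> {..<5}" by metis
  moreover have "(\<Union>v<4. hit v) \<subseteq> {..<5}" by (auto simp: hit_def)
  ultimately obtain l where l: "l < 5" "l \<notin> (\<Union>v<4. hit v)"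
    by (metis lessThan_iff subsetI subset_antisym)
  show thesis
  proof (rule that[OF l(1)])
    fix v :: nat and i :: int and \<tau> :: real
    assume "v < 4" "i \<in> {0..<q}" "\<tau> \<in> {real l * M..real l * M + h}"
    then show "y v + of_int i * \<alpha> + \<tau> * c v \<notin> \<int>"
      using l unfolding hit_def by blast
  qed
qed

section \<open>The roof function\<close>

lemma funpow_deriv_periodic:
  fixes f :: "real \<Rightarrow> real"
  assumes "\<And>x. f (x + 1) = f x"
  shows "(deriv ^^ j) f (x + 1) = (deriv ^^ j) f x"
proof (induction j arbitrary: x)
  case (Suc j)
  then show ?case by (simp add: deriv_def DERIV_shift)
qed (simp add: assms)

text \<open>Continuity at \<beta> ties the additive constants of the two pieces together.\<close>

lemma affine_pieces_tent:
  assumes \<beta>: "0 < \<beta>" "\<beta> < 1" and cont: "continuous_on UNIV g"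
    and per: "\<And>x::real. g (x + 1) = g x"
    and left: "affine_with_slope_on (1 - \<beta>) {0..<\<beta>} g"
    and right: "affine_with_slope_on (- \<beta>) {\<beta>..<1} g"
  obtains c where "\<And>x. g x = c + tent \<beta> x"
proof -
  obtain c where c: "\<And>x. x \<in> {0..<\<beta>} \<Longrightarrow> g x = (1 - \<beta>) * x + c"
    using left by (auto simp: affine_with_slope_on_def)
  obtain c' where c': "\<And>x. x \<in> {\<beta>..<1} \<Longrightarrow> g x = - \<beta> * x + c'"
    using right by (auto simp: affine_with_slope_on_def)
  have "continuous_on (closure {0..<\<beta>}) (\<lambda>x. g x - (1 - \<beta>) * x)"
    by (intro continuous_intros continuous_on_subset[OF cont]) auto
  then have "g \<beta> - (1 - \<beta>) * \<beta> = c"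
    by (rule continuous_constant_on_closure) (use c \<beta> in auto)
  moreover have "g \<beta> = - \<beta> * \<beta> + c'" using c' \<beta> by simp
  ultimately have c'_eq: "c' = c + \<beta>" by (simp add: algebra_simps)
  have "g x = c + tent \<beta> x" for x
  proof -
    have "g x = g (frac x)"
      using periodic_of_int[of g, OF per, of "frac x" "\<lfloor>x\<rfloor>"] by (simp add: frac_def)
    also have "\<dots> = c + tent \<beta> x"
      using c[of "frac x"] c'[of "frac x"] frac_lt_1[of x] \<beta> c'_eq
      by (cases "frac x < \<beta>") (auto simp: tent_def algebra_simps)
    finally show ?thesis .
  qed
  then show thesis by (rule that)
qed

lemma circle_Ck_DERIV:
  assumes "circle_Ck m f" "j < m"
  shows "((deriv ^^ j) f has_real_derivative (deriv ^^ Suc j) f x) (at x)"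
  using assms by (auto simp: circle_Ck_def differentiable_on_def DERIV_deriv_iff_real_differentiable)

context
  fixes r :: nat and f :: "real \<Rightarrow> real" and \<beta> c :: real
  assumes r: "1 \<le> r" and \<beta>: "0 < \<beta>" "\<beta> < 1" and f: "circle_Ck (r - 1) f"
    and top: "\<And>x. (deriv ^^ (r - 1)) f x = c + tent \<beta> x"
begin

lemma roof_periodic: "f (x + 1) = f x"
  using f by (auto simp: circle_Ck_def)

text \<open>Here \<open>n\<close> counts integrations down from the top derivative. The start is the
  sum of tents; each integration gains 1/q because lattice sums have period 1/q.\<close>

lemma lattice_sum_oscillation:
  fixes q :: int
  assumes q: "1 \<le> q" and "n \<le> r - 1"
  shows "\<bar>(\<Sum>i\<in>{0..<q}. (deriv ^^ (r - 1 - n)) f (x + of_int i / of_int q)) -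
          (\<Sum>i\<in>{0..<q}. (deriv ^^ (r - 1 - n)) f (y + of_int i / of_int q))\<bar> \<le> 2 / of_int q ^ (n + 1)"
  using assms(2)
proof (induction n arbitrary: x y)
  case 0
  then show ?case
    using tent_sum_oscillation[OF \<beta> q, of x y] by (simp add: top[unfolded One_nat_def] sum.distrib)
next
  case (Suc n)
  define j where "j = r - 1 - Suc n"
  have j: "r - 1 - n = Suc j" "j < r - 1" using Suc.prems by (auto simp: j_def)
  let ?P = "\<lambda>j x. \<Sum>i\<in>{0..<q}. (deriv ^^ j) f (x + of_int i / of_int q)"
  have "\<bar>?P j x - ?P j y\<bar> \<le> 2 / of_int q ^ (n + 1) * (1 / of_int q)"
  proof (rule oscillation_antiderivative[of _ "?P j" "?P (Suc j)"])
    show "0 < 1 / real_of_int q" using q by simp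
    show "?P j (x + 1 / of_int q) = ?P j x" for x
      by (rule lattice_sum_periodic[of "(deriv ^^ j) f", OF funpow_deriv_periodic[of f, OF roof_periodic] q])
    show "(?P j has_real_derivative ?P (Suc j) x) (at x)" for x
      using circle_Ck_DERIV[OF f j(2)]
      by (intro DERIV_sum) (simp add: DERIV_shift[symmetric] del: funpow.simps)
    show "\<bar>?P (Suc j) x - ?P (Suc j) y\<bar> \<le> 2 / of_int q ^ (n + 1)" for x y
      using Suc.IH[of x y] Suc.prems unfolding j by simp
  qed
  then show ?case unfolding j_def by (simp add: mult_ac)
qed

text \<open>For r = 1 the roof is itself a tent up to a constant. Otherwise the one-point lattice, q
  = 1, bounds the oscillation of \<open>deriv f\<close>.\<close>

lemma roof_lipschitz: "\<bar>f x - f y\<bar> \<le> 2 * \<bar>x - y\<bar>"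
proof (cases "r = 1")
  case True
  then have "\<bar>f x - f y\<bar> \<le> \<bar>x - y\<bar>" using tent_lipschitz[OF \<beta>, of x y] top by simp
  also have "\<dots> \<le> 2 * \<bar>x - y\<bar>" by simp
  finally show ?thesis .
next
  case False
  then have "0 < r - 1" "r - 1 - (r - 2) = 1" using r by auto
  show ?thesis
  proof (rule lipschitz_antiderivative[of 1])
    show "(f has_real_derivative deriv f x) (at x)" for x
      using circle_Ck_DERIV[OF f \<open>0 < r - 1\<close>] by simp
    show "\<bar>deriv f x - deriv f y\<bar> \<le> 2" for x y
    proof -
      have "{0..<1::int} = {0}" by auto
      then show ?thesis
        using lattice_sum_oscillation[of 1 "r - 2" x y] \<open>0 < r - 1\<close>
        unfolding \<open>r - 1 - (r - 2) = 1\<close> by simp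
    qed
  qed (auto simp: roof_periodic)
qed

section \<open>Birkhoff sums over multiples of the denominator\<close>

context
  fixes \<alpha> \<delta> :: real and p q :: int
  assumes q: "1 \<le> q" and cop: "coprime p q" and \<delta>: "of_int q * \<alpha> = of_int p + \<delta>"
begin

lemma birkhoff_sum_q: "birkhoff_sum \<alpha> f q x = (\<Sum>i\<in>{0..<q}. f (x + of_int i * \<alpha>))"
  using q by (simp add: birkhoff_sum_def periodic_rotation_iter[of f, OF roof_periodic])

text \<open>The orbit of length \<open>q\<close> shadows the lattice x + (1/q)\<int>: multiplication
  by \<open>p\<close> permutes the residues modulo \<open>q\<close>, and each point is off by at
  most |\<delta>|. The Lipschitz constant 2 makes this an error of 2q|\<delta>| at each of
  \<open>x\<close> and \<open>y\<close>.\<close>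

lemma birkhoff_sum_oscillation:
  "\<bar>birkhoff_sum \<alpha> f q x - birkhoff_sum \<alpha> f q y\<bar> \<le> 2 / of_int q ^ r + 4 * of_int q * \<bar>\<delta>\<bar>"
proof -
  have q': "0 < real_of_int q" using q by simp
  let ?P = "\<lambda>x. \<Sum>i\<in>{0..<q}. f (x + of_int i / of_int q)"
  have near: "\<bar>birkhoff_sum \<alpha> f q x - ?P x\<bar> \<le> 2 * of_int q * \<bar>\<delta>\<bar>" for x
  proof -
    have inj: "inj_on (\<lambda>i. (i * p) mod q) {0..<q}"
    proof (rule inj_onI)
      fix i i' assume i: "i \<in> {0..<q}" "i' \<in> {0..<q}" "(i * p) mod q = (i' * p) mod q"
      then have "q dvd (i - i') * p" by (simp add: mod_eq_dvd_iff left_diff_distrib)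
      then have "q dvd i - i'" using cop by (simp add: coprime_commute coprime_dvd_mult_left_iff)
      then show "i = i'" using i(1,2) by (simp add: mod_eq_dvd_iff[symmetric])
    qed
    have "(\<lambda>i. (i * p) mod q) ` {0..<q} = {0..<q}"
      using q by (intro endo_inj_surj inj) auto
    then have "?P x = (\<Sum>i\<in>{0..<q}. f (x + of_int ((i * p) mod q) / of_int q))"
      using sum.reindex[OF inj, of "\<lambda>i. f (x + of_int i / of_int q)"] by simp
    also have "\<dots> = (\<Sum>i\<in>{0..<q}. f (x + of_int (i * p) / of_int q))"
    proof (rule sum.cong)
      fix i
      have "real_of_int (i * p) = of_int ((i * p) mod q) + of_int q * of_int ((i * p) div q)"
        by (metis mod_mult_div_eq of_int_add of_int_mult)
      then have "real_of_int (i * p) / of_int q = of_int ((i * p) mod q) / of_int q + of_int ((i * p) div q)"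
        using q' by (simp add: add_divide_distrib)
      then show "f (x + of_int ((i * p) mod q) / of_int q) = f (x + of_int (i * p) / of_int q)"
        using periodic_of_int[of f, OF roof_periodic, of "x + of_int ((i * p) mod q) / of_int q"]
        by (simp add: add.assoc)
    qed simp
    finally have "\<bar>birkhoff_sum \<alpha> f q x - ?P x\<bar>
        = \<bar>\<Sum>i\<in>{0..<q}. f (x + of_int i * \<alpha>) - f (x + of_int (i * p) / of_int q)\<bar>"
      by (simp add: birkhoff_sum_q sum_subtractf)
    also have "\<dots> \<le> (\<Sum>i\<in>{0..<q}. 2 * \<bar>\<delta>\<bar>)"
    proof (rule order.trans[OF sum_abs], rule sum_mono)
      fix i assume i: "i \<in> {0..<q}"
      have \<alpha>: "\<alpha> = (of_int p + \<delta>) / of_int q" using \<delta> q' by (simp add: field_simps)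
      have "\<bar>f (x + of_int i * \<alpha>) - f (x + of_int (i * p) / of_int q)\<bar>
          \<le> 2 * \<bar>x + of_int i * \<alpha> - (x + of_int (i * p) / of_int q)\<bar>" by (rule roof_lipschitz)
      also have "x + of_int i * \<alpha> - (x + of_int (i * p) / of_int q) = (of_int i / of_int q) * \<delta>"
        unfolding \<alpha> by (simp add: add_divide_distrib distrib_left)
      also have "\<bar>(of_int i / of_int q) * \<delta>\<bar> \<le> 1 * \<bar>\<delta>\<bar>"
        unfolding abs_mult using i q' by (intro mult_right_mono) auto
      finally show "\<bar>f (x + of_int i * \<alpha>) - f (x + of_int (i * p) / of_int q)\<bar> \<le> 2 * \<bar>\<delta>\<bar>" by simp
    qed
    also have "\<dots> = 2 * of_int q * \<bar>\<delta>\<bar>" using q by simp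
    finally show ?thesis .
  qed
  have "\<bar>?P x - ?P y\<bar> \<le> 2 / of_int q ^ r"
    using lattice_sum_oscillation[OF q, of "r - 1" x y] r by simp
  with near[of x] near[of y] show ?thesis by linarith
qed

lemma birkhoff_sum_q_shift:
  "birkhoff_sum \<alpha> f q (x + of_int (int m * q) * \<alpha>) = birkhoff_sum \<alpha> f q (x + real m * \<delta>)"
proof -
  have eq: "x + of_int (int m * q) * \<alpha> = x + real m * \<delta> + of_int (int m * p)"
    using \<delta> by (simp add: mult.assoc distrib_left)
  have "birkhoff_sum \<alpha> f q (x + 1) = birkhoff_sum \<alpha> f q x" for x
    using roof_periodic by (simp add: birkhoff_sum_q add.assoc[symmetric] add.commute[of _ 1] add.left_commute[of _ 1])
      (metis add.commute add.left_commute roof_periodic)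
  then show ?thesis unfolding eq by (rule periodic_of_int)
qed

lemma birkhoff_sum_multiple:
  "birkhoff_sum \<alpha> f (int m * q) x = (\<Sum>j<m. birkhoff_sum \<alpha> f q (x + real j * \<delta>))"
proof (induction m)
  case (Suc m)
  have "int (Suc m) * q = int m * q + q" by (simp add: algebra_simps)
  then show ?case
    using birkhoff_sum_add[of f, OF roof_periodic, of \<alpha> "int m * q" q x] birkhoff_sum_q_shift[of x m] Suc
    by simp
qed simp

text \<open>The offset \<open>j + 1\<close>, against \<open>j\<close> for positive times, arises
  because the backward block number \<open>j\<close> starts \<open>j + 1\<close> steps before
  \<open>x\<close>.\<close>

lemma birkhoff_sum_neg_multiple:
  "birkhoff_sum \<alpha> f (- (int m * q)) x = - (\<Sum>j<m. birkhoff_sum \<alpha> f q (x - (real j + 1) * \<delta>))"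
proof (induction m)
  case (Suc m)
  have "- (int (Suc m) * q) + q = - (int m * q)" by (simp add: algebra_simps)
  then have "birkhoff_sum \<alpha> f (- (int m * q)) x = birkhoff_sum \<alpha> f (- (int (Suc m) * q)) x
      + birkhoff_sum \<alpha> f q (x + of_int (- (int (Suc m) * q)) * \<alpha>)"
    using birkhoff_sum_add[of f, OF roof_periodic, of \<alpha> "- (int (Suc m) * q)" q x] by simp
  also have "birkhoff_sum \<alpha> f q (x + of_int (- (int (Suc m) * q)) * \<alpha>)
      = birkhoff_sum \<alpha> f q (x - (real m + 1) * \<delta>)"
    using birkhoff_sum_q_shift[of "x - of_int (int (Suc m) * q) * \<alpha> - real (Suc m) * \<delta>" "Suc m"]
    by (simp add: algebra_simps)
  finally show ?case using Suc by simp
qed simp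

lemma birkhoff_sum_multiple_bound:
  "\<bar>birkhoff_sum \<alpha> f (int m * q) x - real m * birkhoff_sum \<alpha> f q 0\<bar>
    \<le> real m * (2 / of_int q ^ r + 4 * of_int q * \<bar>\<delta>\<bar>)"
proof -
  have "birkhoff_sum \<alpha> f (int m * q) x - real m * birkhoff_sum \<alpha> f q 0
      = (\<Sum>j<m. birkhoff_sum \<alpha> f q (x + real j * \<delta>) - birkhoff_sum \<alpha> f q 0)"
    by (simp add: birkhoff_sum_multiple sum_subtractf)
  also have "\<bar>\<dots>\<bar> \<le> (\<Sum>j<m. 2 / of_int q ^ r + 4 * of_int q * \<bar>\<delta>\<bar>)"
    by (intro order.trans[OF sum_abs] sum_mono birkhoff_sum_oscillation)
  finally show ?thesis by simp
qed

text \<open>In the variable \<tau> one orbit piece moves with velocity \<delta> and the other with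
  -\<delta>. Odd \<open>r\<close> makes their slopes add instead of cancel, which yields an integer
  minus 2q\<beta>. The breakpoint-free length is (r + 1)w: \<open>w\<close> for the range of \<tau>,
  (r - 1)w for the intermediate point, and \<open>w\<close> for the last increment.\<close>

lemma block_difference:
  fixes w :: nat and x x' h m :: real and \<sigma> :: "int \<Rightarrow> real \<Rightarrow> real"
  assumes "odd r" and w: "1 \<le> w"
    and free: "\<And>i \<tau>. i \<in> {0..<q} \<Longrightarrow> \<tau> \<in> {m..m + real (r + 1) * real w} \<Longrightarrow>
      x' + of_int i * \<alpha> + \<tau> * \<delta> \<notin> \<int> \<and> x' - \<beta> + of_int i * \<alpha> + \<tau> * \<delta> \<notin> \<int> \<and>
      x - \<delta> + of_int i * \<alpha> + \<tau> * (- \<delta>) \<notin> \<int> \<and> x - \<delta> - \<beta> + of_int i * \<alpha> + \<tau> * (- \<delta>) \<notin> \<int>"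
  obtains N :: int where
    "\<And>\<tau>. \<tau> \<in> {m..m + real w} \<Longrightarrow>
      fdiff r (real w) (\<lambda>\<tau>. birkhoff_sum \<alpha> f q (x' + \<tau> * \<delta>) - birkhoff_sum \<alpha> f q (x - (\<tau> + 1) * \<delta>)) \<tau>
        = (real w * \<delta>) ^ r * (of_int N - 2 * of_int q * \<beta>)"
proof -
  let ?F = "\<lambda>j. (deriv ^^ j) f"
  define k where "k = r - 1"
  have k: "r = Suc k" "even k" using r \<open>odd r\<close> by (auto simp: k_def)
  define y where "y i \<tau> = x' + of_int i * \<alpha> + \<tau> * \<delta>" for i and \<tau> :: real
  define y' where "y' i \<tau> = x - \<delta> + of_int i * \<alpha> + \<tau> * (- \<delta>)" for i and \<tau> :: real
  \<comment> \<open>\<open>G j\<close> is the j-th derivative in \<tau> of the difference of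
    Birkhoff sums; the chain rule produces the powers of \<delta> and -\<delta>.\<close>
  define G where "G j \<tau> = (\<Sum>i\<in>{0..<q}. \<delta> ^ j * ?F j (y i \<tau>) - (- \<delta>) ^ j * ?F j (y' i \<tau>))" for j \<tau>
  define n where "n i = \<lfloor>y i m\<rfloor> - \<lfloor>y i m - \<beta>\<rfloor>" for i
  define n' where "n' i = \<lfloor>y' i m\<rfloor> - \<lfloor>y' i m - \<beta>\<rfloor>" for i
  define N where "N = (\<Sum>i\<in>{0..<q}. n i + n' i)"
  have G_deriv: "(G j has_real_derivative G (Suc j) \<tau>) (at \<tau>)" if "j < k" for j \<tau>
  proof -
    have F: "(?F j has_real_derivative ?F (Suc j) z) (at z)" for z
      using circle_Ck_DERIV[OF f] that unfolding k_def by blast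
    have y_der: "(y i has_real_derivative \<delta>) (at \<tau>)" "(y' i has_real_derivative - \<delta>) (at \<tau>)" for i
      unfolding y_def[abs_def] y'_def[abs_def] by (auto intro!: derivative_eq_intros)
    show ?thesis
      unfolding G_def[abs_def]
    proof (rule DERIV_sum)
      fix i
      show "((\<lambda>\<tau>. \<delta> ^ j * ?F j (y i \<tau>) - (- \<delta>) ^ j * ?F j (y' i \<tau>)) has_real_derivative
          \<delta> ^ Suc j * ?F (Suc j) (y i \<tau>) - (- \<delta>) ^ Suc j * ?F (Suc j) (y' i \<tau>)) (at \<tau>)"
        using DERIV_diff[OF DERIV_cmult[OF DERIV_chain2[OF F y_der(1)]] 
            DERIV_cmult[OF DERIV_chain2[OF F y_der(2)]], of "\<delta> ^ j" i "(- \<delta>) ^ j" i]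
        by (simp add: mult_ac del: funpow.simps)
    qed
  qed
  have G_affine: "G k (\<xi> + real w) - G k \<xi> = real w * (\<delta> ^ r * (of_int N - 2 * of_int q * \<beta>))"
    if \<xi>: "\<xi> \<in> {m..m + real r * real w}" for \<xi>
  proof -
    have in_block: "m \<in> {m..m + real (r + 1) * real w}" "\<xi> \<in> {m..m + real (r + 1) * real w}"
      "\<xi> + real w \<in> {m..m + real (r + 1) * real w}"
      using \<xi> w by (auto simp: algebra_simps)
    have step: "tent \<beta> (y i (\<xi> + real w)) - tent \<beta> (y i \<xi>) = (of_int (n i) - \<beta>) * (real w * \<delta>)"
      "tent \<beta> (y' i (\<xi> + real w)) - tent \<beta> (y' i \<xi>) = - ((of_int (n' i) - \<beta>) * (real w * \<delta>))"
      if i: "i \<in> {0..<q}" for i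
    proof -
      have fl: "\<lfloor>y i \<tau>\<rfloor> = \<lfloor>y i m\<rfloor>" "\<lfloor>y i \<tau> - \<beta>\<rfloor> = \<lfloor>y i m - \<beta>\<rfloor>"
        "\<lfloor>y' i \<tau>\<rfloor> = \<lfloor>y' i m\<rfloor>" "\<lfloor>y' i \<tau> - \<beta>\<rfloor> = \<lfloor>y' i m - \<beta>\<rfloor>"
        if "\<tau> \<in> {m..m + real (r + 1) * real w}" for \<tau>
        using floor_constant_on_line[of m "m + real (r + 1) * real w" "x' + of_int i * \<alpha>" \<delta> \<tau> m]
          floor_constant_on_line[of m "m + real (r + 1) * real w" "x' - \<beta> + of_int i * \<alpha>" \<delta> \<tau> m]
          floor_constant_on_line[of m "m + real (r + 1) * real w" "x - \<delta> + of_int i * \<alpha>" "- \<delta>" \<tau> m]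
          floor_constant_on_line[of m "m + real (r + 1) * real w" "x - \<delta> - \<beta> + of_int i * \<alpha>" "- \<delta>" \<tau> m]
          free[OF i] that in_block(1)
        unfolding y_def y'_def by (simp_all add: algebra_simps)
      have "tent \<beta> (y i (\<xi> + real w)) - tent \<beta> (y i \<xi>) = (of_int (n i) - \<beta>) * (y i (\<xi> + real w) - y i \<xi>)"
        unfolding n_def using fl[OF in_block(2)] fl[OF in_block(3)] by (subst tent_affine[OF \<beta>]) auto
      then show "tent \<beta> (y i (\<xi> + real w)) - tent \<beta> (y i \<xi>) = (of_int (n i) - \<beta>) * (real w * \<delta>)"
        by (simp add: y_def algebra_simps)
      have "tent \<beta> (y' i (\<xi> + real w)) - tent \<beta> (y' i \<xi>) = (of_int (n' i) - \<beta>) * (y' i (\<xi> + real w) - y' i \<xi>)"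
        unfolding n'_def using fl[OF in_block(2)] fl[OF in_block(3)] by (subst tent_affine[OF \<beta>]) auto
      then show "tent \<beta> (y' i (\<xi> + real w)) - tent \<beta> (y' i \<xi>) = - ((of_int (n' i) - \<beta>) * (real w * \<delta>))"
        by (simp add: y'_def algebra_simps)
    qed
    have Fk: "?F k z = c + tent \<beta> z" for z using top by (simp add: k_def)
    \<comment> \<open>As \<open>k\<close> is even, the powers of \<delta> and -\<delta> agree. The
      points \<open>y'\<close> run backwards, so subtracting their increments adds their
      slopes.\<close>
    have "G k (\<xi> + real w) - G k \<xi> = (\<Sum>i\<in>{0..<q}. \<delta> ^ k *
        ((tent \<beta> (y i (\<xi> + real w)) - tent \<beta> (y i \<xi>)) - (tent \<beta> (y' i (\<xi> + real w)) - tent \<beta> (y' i \<xi>))))"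
      unfolding G_def sum_subtractf[symmetric] using k(2)
      by (intro sum.cong) (auto simp: Fk algebra_simps)
    also have "\<dots> = (\<Sum>i\<in>{0..<q}. real w * \<delta> ^ r * (of_int (n i + n' i) - 2 * \<beta>))"
      unfolding k(1) by (intro sum.cong) (auto simp: step algebra_simps)
    also have "\<dots> = real w * (\<delta> ^ r * (of_int N - 2 * of_int q * \<beta>))"
      using q by (simp add: N_def sum_distrib_left[symmetric] sum_subtractf mult.assoc)
    finally show ?thesis .
  qed
  have G0: "G 0 = (\<lambda>\<tau>. birkhoff_sum \<alpha> f q (x' + \<tau> * \<delta>) - birkhoff_sum \<alpha> f q (x - (\<tau> + 1) * \<delta>))"
    by (simp add: fun_eq_iff G_def birkhoff_sum_q sum_subtractf y_def y'_def algebra_simps)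
  show thesis
  proof (rule that[of N])
    fix \<tau> assume \<tau>: "\<tau> \<in> {m..m + real w}"
    have "fdiff (Suc k) (real w) (G 0) \<tau> = real w ^ Suc k * (\<delta> ^ r * (of_int N - 2 * of_int q * \<beta>))"
    proof (rule fdiff_eq_if_affine_derivative)
      show "0 < real w" using w by simp
      show "(G j has_real_derivative G (Suc j) x) (at x)" if "j < k" for j x
        using G_deriv[OF that] .
      fix \<xi> assume "\<xi> \<in> {\<tau>..\<tau> + real k * real w}"
      then have "\<xi> \<in> {m..m + real r * real w}" using \<tau> k(1) by (auto simp: algebra_simps)
      then show "G k (\<xi> + real w) - G k \<xi> = real w * (\<delta> ^ r * (of_int N - 2 * of_int q * \<beta>))"
        by (rule G_affine)
    qed
    then show "fdiff r (real w) (\<lambda>\<tau>. birkhoff_sum \<alpha> f q (x' + \<tau> * \<delta>) - birkhoff_sum \<alpha> f q (x - (\<tau> + 1) * \<delta>)) \<tau>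
        = (real w * \<delta>) ^ r * (of_int N - 2 * of_int q * \<beta>)"
      unfolding G0 k(1)[symmetric] by (simp add: power_mult_distrib mult.assoc)
  qed
qed

text \<open>The bounds in \<open>close\<close> control a difference of order r + 1 of the
  displacement sums, which \<open>block_difference\<close> evaluates on a block without breakpoints.
  The number 5(r + 2) provides five blocks of r + 2 sampling times each.\<close>

lemma displacement_lower_bound:
  fixes w :: nat and x x' \<eta> \<epsilon> :: real
  assumes "odd r" and "\<delta> \<noteq> 0" and w: "1 \<le> w"
    and small: "of_int q * ((5 * (real (r + 2) * real w) + 1) * \<bar>\<delta>\<bar>) < 1"
    and far: "\<And>N::int. \<epsilon> \<le> \<bar>2 * of_int q * \<beta> - of_int N\<bar>"
    and close: "\<And>i. i < 5 * (r + 2) \<Longrightarrow> \<bar>birkhoff_sum \<alpha> f (int (i * w) * q) x' +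
        birkhoff_sum \<alpha> f (- (int (i * w) * q)) x\<bar> \<le> \<eta>"
  shows "real w * (real w * \<bar>\<delta>\<bar>) ^ r * \<epsilon> \<le> 2 ^ (r + 1) * \<eta>"
proof -
  define g where "g \<tau> = birkhoff_sum \<alpha> f q (x' + \<tau> * \<delta>) - birkhoff_sum \<alpha> f q (x - (\<tau> + 1) * \<delta>)" for \<tau>
  \<comment> \<open>The four families: the forward piece from \<open>x'\<close> and the backward
    piece from \<open>x - \<delta>\<close>, each meeting the breakpoints 0 and \<beta>.\<close>
  define y :: "nat \<Rightarrow> real" where "y v = [x', x' - \<beta>, x - \<delta>, x - \<delta> - \<beta>] ! v" for v
  define d :: "nat \<Rightarrow> real" where "d v = [\<delta>, \<delta>, - \<delta>, - \<delta>] ! v" for v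
  define M where "M = real (r + 2) * real w"
  have four: "v = 0 \<or> v = 1 \<or> v = 2 \<or> v = 3" if "v < 4" for v :: nat using that by auto
  obtain l :: nat where l: "l < 5" and
    free: "\<And>v i \<tau>. v < 4 \<Longrightarrow> i \<in> {0..<q} \<Longrightarrow> \<tau> \<in> {real l * M..real l * M + real (r + 1) * real w} \<Longrightarrow>
       y v + of_int i * \<alpha> + \<tau> * d v \<notin> \<int>"
  proof (rule exists_block_without_breakpoints[OF q cop \<delta> \<open>\<delta> \<noteq> 0\<close>, of "real (r + 1) * real w" M d y])
    show "d v = \<delta> \<or> d v = - \<delta>" if "v < 4" for v using four[OF that] by (auto simp: d_def)
  qed (use w small in \<open>auto simp: M_def\<close>)
  define m where "m = l * ((r + 2) * w)"
  have m: "real m = real l * M" by (simp add: m_def M_def algebra_simps)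
  obtain N :: int where N: "\<And>\<tau>. \<tau> \<in> {real m..real m + real w} \<Longrightarrow>
      fdiff r (real w) g \<tau> = (real w * \<delta>) ^ r * (of_int N - 2 * of_int q * \<beta>)"
    unfolding g_def
  proof (rule block_difference[OF \<open>odd r\<close> w, of "real m" x' x])
    fix i and \<tau> :: real assume "i \<in> {0..<q}" "\<tau> \<in> {real m..real m + real (r + 1) * real w}"
    then show "x' + of_int i * \<alpha> + \<tau> * \<delta> \<notin> \<int> \<and> x' - \<beta> + of_int i * \<alpha> + \<tau> * \<delta> \<notin> \<int> \<and>
      x - \<delta> + of_int i * \<alpha> + \<tau> * (- \<delta>) \<notin> \<int> \<and> x - \<delta> - \<beta> + of_int i * \<alpha> + \<tau> * (- \<delta>) \<notin> \<int>"
      using free[of 0 i \<tau>] free[of 1 i \<tau>] free[of 2 i \<tau>] free[of 3 i \<tau>]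
      unfolding m y_def d_def by (simp add: numeral_2_eq_2 numeral_3_eq_3)
  qed blast
  define E where "E n = birkhoff_sum \<alpha> f (int n * q) x' + birkhoff_sum \<alpha> f (- (int n * q)) x" for n
  have E: "E n = (\<Sum>j<n. g (real j))" for n
    unfolding E_def birkhoff_sum_multiple birkhoff_sum_neg_multiple by (simp add: g_def sum_subtractf)
  \<comment> \<open>Sums of \<open>w\<close> consecutive terms are differences of \<open>E\<close>
    at neighbouring multiples of \<open>w\<close>, where \<open>close\<close> applies.\<close>
  define e where "e \<tau> = (\<Sum>j<w. g (\<tau> + real j))" for \<tau>
  have "\<bar>e (real m + real i * real w)\<bar> \<le> 2 * \<eta>" if i: "i \<le> r" for i
  proof -
    have "m + i * w = (l * (r + 2) + i) * w" "m + i * w + w = (l * (r + 2) + i + 1) * w"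
      by (simp_all add: m_def algebra_simps)
    moreover have "l * (r + 2) \<le> 4 * (r + 2)" using l by (intro mult_right_mono) auto
    then have "l * (r + 2) + i + 1 < 5 * (r + 2)" using i by simp
    then have "l * (r + 2) + i < 5 * (r + 2)" "l * (r + 2) + i + 1 < 5 * (r + 2)" by simp_all
    ultimately have "\<bar>E (m + i * w)\<bar> \<le> \<eta>" "\<bar>E (m + i * w + w)\<bar> \<le> \<eta>"
      unfolding E_def using close by metis+
    moreover have "e (real m + real i * real w) = E (m + i * w + w) - E (m + i * w)"
      unfolding E e_def sum.lessThan_Suc
      using sum.atLeastLessThan_concat[of 0 "m + i * w" "m + i * w + w" "\<lambda>j. g (real j)"]
        sum.shift_bounds_nat_ivl[of "\<lambda>j. g (real j)" 0 "m + i * w" w]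
      by (simp add: atLeast0LessThan add_ac)
    ultimately show ?thesis by linarith
  qed
  then have "\<bar>fdiff r (real w) e (real m)\<bar> \<le> 2 ^ r * (2 * \<eta>)" by (rule fdiff_bound)
  also have "fdiff r (real w) e (real m) = (\<Sum>j<w. fdiff r (real w) g (real m + real j))"
    unfolding e_def[abs_def] fdiff_sum by (simp add: fdiff_shift)
  also have "\<dots> = (\<Sum>j<w. (real w * \<delta>) ^ r * (of_int N - 2 * of_int q * \<beta>))"
    by (intro sum.cong N) auto
  also have "\<bar>\<dots>\<bar> = real w * (real w * \<bar>\<delta>\<bar>) ^ r * \<bar>2 * of_int q * \<beta> - of_int N\<bar>"
    by (simp add: abs_mult power_abs abs_minus_commute)
  finally have "real w * (real w * \<bar>\<delta>\<bar>) ^ r * \<bar>2 * of_int q * \<beta> - of_int N\<bar> \<le> 2 ^ (r + 1) * \<eta>"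
    by simp
  moreover have "real w * (real w * \<bar>\<delta>\<bar>) ^ r * \<epsilon> \<le> real w * (real w * \<bar>\<delta>\<bar>) ^ r * \<bar>2 * of_int q * \<beta> - of_int N\<bar>"
    by (intro mult_left_mono far) auto
  ultimately show ?thesis by linarith
qed

end

end

section \<open>Choice of the scales and conclusion\<close>

lemma strict_mono_int_ge:
  fixes Q :: "nat \<Rightarrow> int"
  assumes "strict_mono Q"
  shows "Q 0 + int n \<le> Q n"
proof (induction n)
  case (Suc n)
  then show ?case using strict_monoD[OF assms, of n "Suc n"] by simp
qed simp

theorem theorem5p2:
  fixes r :: nat and \<alpha> \<kappa> :: real and k :: "nat \<Rightarrow> nat"
  assumes "r \<ge> 1" and "odd r"
    and "\<alpha> \<notin> \<rat>"
    and "strict_mono k"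
    and "(\<lambda>n. of_int (cf_denom \<alpha> (k n)) ^ (r + 1) *
              infdist (of_int (cf_denom \<alpha> (k n)) * \<alpha>) \<int>) \<longlonglongrightarrow> \<kappa>"
    and "0 < \<kappa>" and "\<kappa> < 1 / (2 * (real r + 1))"
  shows "AE \<beta> in lebesgue_on {0<..<1}. \<forall>f :: real \<Rightarrow> real.
           (\<forall>x. f x > 0) \<and> circle_Ck (r - 1) f \<and>
           affine_with_slope_on (1 - \<beta>) {0..<\<beta>} ((deriv ^^ (r - 1)) f) \<and>
           affine_with_slope_on (- \<beta>) {\<beta>..<1} ((deriv ^^ (r - 1)) f) \<longrightarrow>
           \<not> isomorphic_to_inverse (special_flow_measure f) (special_flow \<alpha> f)"
proof -
  \<comment> \<open>The first term of the subsequence is dropped, so that all indices are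
    successors, as \<open>cf_denom_strict_mono\<close> and \<open>infdist_cf\<close> demand.\<close>
  define l where "l n = k (Suc n) - 1" for n
  have l: "k (Suc n) = Suc (l n)" for n
    using strict_monoD[OF \<open>strict_mono k\<close>, of n "Suc n"] by (simp add: l_def)
  define q where "q n = cf_denom \<alpha> (Suc (l n))" for n
  have "strict_mono l"
    using strict_monoD[OF \<open>strict_mono k\<close>] l by (intro strict_monoI) (metis Suc_less_eq)
  then have q_mono: "strict_mono q"
    using strict_monoD[OF cf_denom_strict_mono[OF \<open>\<alpha> \<notin> \<rat>\<close>]] strict_monoD[of l]
    unfolding q_def by (intro strict_monoI) blast
  have q_pos: "1 \<le> q n" for n unfolding q_def by (rule cf_denom_pos[OF \<open>\<alpha> \<notin> \<rat>\<close>])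
  define \<delta> where "\<delta> n = cf_error \<alpha> (Suc (l n))" for n
  define p where "p n = cf_num \<alpha> (Suc (l n))" for n
  have \<delta>: "of_int (q n) * \<alpha> = of_int (p n) + \<delta> n" for n
    by (simp add: \<delta>_def q_def p_def cf_error_def)
  have cop: "coprime (p n) (q n)" for n unfolding p_def q_def by (rule coprime_cf)
  have \<delta>_lim: "(\<lambda>n. of_int (q n) ^ (r + 1) * \<bar>\<delta> n\<bar>) \<longlonglongrightarrow> \<kappa>"
    using LIMSEQ_Suc[OF assms(5)] unfolding l infdist_cf[OF \<open>\<alpha> \<notin> \<rat>\<close>] q_def \<delta>_def .
  have "strict_mono (\<lambda>n. 2 * q n)" "\<And>n. 0 < 2 * q n"
    using q_mono q_pos by (auto simp: strict_mono_def intro: less_le_trans[OF zero_less_one])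
  from AE_frequently_far_from_Ints[OF this] show ?thesis
    using AE_space
  proof eventually_elim
    case (elim \<beta>)
    then have \<beta>: "0 < \<beta>" "\<beta> < 1" by (auto simp: space_restrict_space)
    show ?case
    proof (intro allI impI notI, elim conjE)
      fix f :: "real \<Rightarrow> real"
      assume pos: "\<forall>x. f x > 0" and f: "circle_Ck (r - 1) f"
        and left: "affine_with_slope_on (1 - \<beta>) {0..<\<beta>} ((deriv ^^ (r - 1)) f)"
        and right: "affine_with_slope_on (- \<beta>) {\<beta>..<1} ((deriv ^^ (r - 1)) f)"
        and iso: "isomorphic_to_inverse (special_flow_measure f) (special_flow \<alpha> f)"
      have per: "f (x + 1) = f x" for x using f by (auto simp: circle_Ck_def)
      have "continuous_on UNIV ((deriv ^^ (r - 1)) f)" using f by (auto simp: circle_Ck_def)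
      then obtain c where top: "\<And>x. (deriv ^^ (r - 1)) f x = c + tent \<beta> x"
        using affine_pieces_tent[OF \<beta> _ funpow_deriv_periodic[of f, OF per] left right] by blast
      note roof = \<open>r \<ge> 1\<close> \<beta> f top
      obtain e where "0 < e" and displace:
        "\<And>\<eta> K. 0 < \<eta> \<Longrightarrow> \<exists>d>0. \<forall>N t.
           (\<forall>i<K::nat. (\<exists>P::int. \<bar>of_int (N i) * \<alpha> - of_int P\<bar> \<le> d) \<and>
              (\<forall>x. \<bar>birkhoff_sum \<alpha> f (N i) x - t i\<bar> \<le> e)) \<longrightarrow>
           (\<exists>x x'. \<forall>i<K. \<bar>birkhoff_sum \<alpha> f (N i) x' + birkhoff_sum \<alpha> f (- N i) x\<bar> \<le> \<eta>)"
        using special_flow_reversal_displacements[of f 2 \<alpha>] per pos roof_lipschitz[OF roof] iso by metis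
      define R where "R = 5 * (r + 2)"
      have "0 < R" by (simp add: R_def)
      \<comment> \<open>The block length \<open>w\<close> will be about \<open>a * q ^ r\<close>.
        The first bound keeps the deviations of the Birkhoff sums below \<open>e\<close>, the second
        keeps \<open>q\<close> times the total drift below 1/2.\<close>
      define a where "a = min (e / (R * (2 + 8 * \<kappa>))) (1 / (4 * R * \<kappa>))"
      have a: "0 < a" "R * a * (2 + 8 * \<kappa>) \<le> e" "R * a * (2 * \<kappa>) \<le> 1 / 2"
      proof -
        show "0 < a" using \<open>0 < e\<close> \<open>0 < R\<close> \<open>0 < \<kappa>\<close> by (simp add: a_def)
        have "R * a * (2 + 8 * \<kappa>) \<le> R * (e / (R * (2 + 8 * \<kappa>))) * (2 + 8 * \<kappa>)"
          using \<open>0 < \<kappa>\<close> by (intro mult_right_mono mult_left_mono) (auto simp: a_def)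
        then show "R * a * (2 + 8 * \<kappa>) \<le> e" using \<open>0 < R\<close> \<open>0 < \<kappa>\<close> by simp
        have "R * a * (2 * \<kappa>) \<le> R * (1 / (4 * R * \<kappa>)) * (2 * \<kappa>)"
          using \<open>0 < \<kappa>\<close> by (intro mult_right_mono mult_left_mono) (auto simp: a_def)
        then show "R * a * (2 * \<kappa>) \<le> 1 / 2" using \<open>0 < R\<close> \<open>0 < \<kappa>\<close> by simp
      qed
      \<comment> \<open>A lower bound for the left side of \<open>displacement_lower_bound\<close>,
        independent of \<open>n\<close>, from w \<ge> aS/2, w|\<delta>| \<ge> a\<kappa>/(4s) and the
        distance 1/6. The choice of \<eta> makes the right side b/2.\<close>
      define b where "b = (a * \<kappa> / 4) ^ r * (a / 2) / 6"
      have "0 < b" using \<open>0 < \<kappa>\<close> a by (simp add: b_def)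
      define \<eta> where "\<eta> = b / 2 ^ (r + 2)"
      have "0 < \<eta>" using \<open>0 < b\<close> by (simp add: \<eta>_def)
      obtain d where "0 < d" and d:
        "\<And>N t. (\<forall>i<R. (\<exists>P::int. \<bar>of_int (N i) * \<alpha> - of_int P\<bar> \<le> d) \<and>
              (\<forall>x. \<bar>birkhoff_sum \<alpha> f (N i) x - t i\<bar> \<le> e)) \<Longrightarrow>
           \<exists>x x'. \<forall>i<R. \<bar>birkhoff_sum \<alpha> f (N i) x' + birkhoff_sum \<alpha> f (- N i) x\<bar> \<le> \<eta>"
        using displace[OF \<open>0 < \<eta>\<close>, of R] by blast
      have "\<forall>\<^sub>F n in sequentially. \<kappa> / 2 < of_int (q n) ^ (r + 1) * \<bar>\<delta> n\<bar>"
        "\<forall>\<^sub>F n in sequentially. of_int (q n) ^ (r + 1) * \<bar>\<delta> n\<bar> < 2 * \<kappa>"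
        using \<open>0 < \<kappa>\<close>
        by (intro order_tendstoD(1)[OF \<delta>_lim] order_tendstoD(2)[OF \<delta>_lim]; simp)+
      \<comment> \<open>The three summands serve in turn for \<open>a * S > 2\<close>, so that the
        floor \<open>w\<close> is at least half of \<open>a * S\<close>; for s|\<delta>| < 1/2; and
        for a drift of at most \<open>d\<close>.\<close>
      moreover have "\<forall>\<^sub>F n in sequentially. 2 / a + 4 * \<kappa> + 1 / d < of_int (q n)"
      proof -
        let ?T = "2 / a + 4 * \<kappa> + 1 / d"
        have "?T < of_int (q n)" if "nat \<lceil>?T\<rceil> < n" for n
        proof -
          have "?T \<le> real (nat \<lceil>?T\<rceil>)" by (rule real_nat_ceiling_ge)
          also have "\<dots> < real n" using that by simp
          also have "\<dots> \<le> of_int (q n)"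
            using strict_mono_int_ge[OF q_mono, of n] q_pos[of 0] by linarith
          finally show ?thesis .
        qed
        then show ?thesis by (rule eventually_mono[OF eventually_gt_at_top])
      qed
      ultimately have "\<forall>\<^sub>F n in sequentially. \<kappa> / 2 < of_int (q n) ^ (r + 1) * \<bar>\<delta> n\<bar> \<and>
          of_int (q n) ^ (r + 1) * \<bar>\<delta> n\<bar> < 2 * \<kappa> \<and> 2 / a + 4 * \<kappa> + 1 / d < of_int (q n)"
        by (intro eventually_conj)
      \<comment> \<open>The distance of 2q\<beta> from the integers is controlled only for
        infinitely many \<open>n\<close>, the other estimates for all large
        \<open>n\<close>.\<close>
      from frequently_ex[OF frequently_eventually_frequently[OF elim(1) this]]
      obtain n where "\<forall>N::int. 1 / 6 \<le> \<bar>of_int (2 * q n) * \<beta> - of_int N\<bar>"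
        and \<delta>n: "\<kappa> / 2 < of_int (q n) ^ (r + 1) * \<bar>\<delta> n\<bar>" "of_int (q n) ^ (r + 1) * \<bar>\<delta> n\<bar> < 2 * \<kappa>"
        and big: "2 / a + 4 * \<kappa> + 1 / d < of_int (q n)"
        by blast
      then have far: "\<And>N::int. 1 / 6 \<le> \<bar>2 * of_int (q n) * \<beta> - of_int N\<bar>" by simp
      define s where "s = real_of_int (q n)"
      define S where "S = s ^ r"
      have s: "1 \<le> s" using q_pos[of n] by (simp add: s_def)
      have S: "s \<le> S" "1 \<le> S" using power_increasing[OF \<open>r \<ge> 1\<close> s] s by (simp_all add: S_def)
      have parts: "0 < 2 / a" "0 < 4 * \<kappa>" "0 < 1 / d" using a \<open>0 < \<kappa>\<close> \<open>0 < d\<close> by auto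
      have sS: "\<kappa> / 2 < s * S * \<bar>\<delta> n\<bar>" "s * S * \<bar>\<delta> n\<bar> < 2 * \<kappa>"
        using \<delta>n by (simp_all add: s_def S_def mult.commute mult.left_commute)
      have "\<delta> n \<noteq> 0" using sS \<open>0 < \<kappa>\<close> by auto
      have "2 / a < S" "4 * \<kappa> < S" "1 / d < s" using big parts S unfolding s_def[symmetric] by linarith+
      then have aS: "2 < a * S" and ds: "1 < d * s"
        using a \<open>0 < d\<close> by (simp_all add: field_simps)
      define w where "w = nat \<lfloor>a * S\<rfloor>"
      have w: "real w \<le> a * S" "a * S / 2 \<le> real w" "1 \<le> w"
        using aS unfolding w_def by linarith+
      define N where "N i = int (i * w) * q n" for i
      have Rw: "real (i * w) \<le> R * a * S" if "i < R" for i
      proof -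
        have "real i * real w \<le> real R * (a * S)" using that w by (intro mult_mono) auto
        then show ?thesis by simp
      qed
      have "\<exists>x x'. \<forall>i<R. \<bar>birkhoff_sum \<alpha> f (N i) x' + birkhoff_sum \<alpha> f (- N i) x\<bar> \<le> \<eta>"
      proof (rule d[where t = "\<lambda>i. real (i * w) * birkhoff_sum \<alpha> f (q n) 0"], intro allI impI conjI)
        fix i assume i: "i < R"
        have "of_int (N i) * \<alpha> - of_int (int (i * w) * p n) = real (i * w) * \<delta> n"
          using \<delta>[of n] by (simp add: N_def mult.assoc distrib_left)
        moreover have "\<bar>real (i * w) * \<delta> n\<bar> \<le> d"
        proof -
          have "s * \<bar>real (i * w) * \<delta> n\<bar> \<le> s * (R * a * S * \<bar>\<delta> n\<bar>)"
            unfolding abs_mult using s Rw[OF i] by (intro mult_left_mono mult_right_mono) auto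
          also have "\<dots> = R * a * (s * S * \<bar>\<delta> n\<bar>)" by (simp add: mult_ac)
          also have "\<dots> \<le> R * a * (2 * \<kappa>)" using sS a by (intro mult_left_mono) auto
          also have "\<dots> \<le> s * d" using a(3) ds mult.commute[of d s] by linarith
          finally show ?thesis using s by simp
        qed
        ultimately show "\<exists>P::int. \<bar>of_int (N i) * \<alpha> - of_int P\<bar> \<le> d" by metis
        fix x
        have "\<bar>birkhoff_sum \<alpha> f (N i) x - real (i * w) * birkhoff_sum \<alpha> f (q n) 0\<bar>
            \<le> real (i * w) * (2 / S + 4 * s * \<bar>\<delta> n\<bar>)"
          using birkhoff_sum_multiple_bound[OF roof q_pos cop \<delta>, of "i * w" n x]
          unfolding N_def S_def s_def .
        also have "\<dots> \<le> R * a * S * (2 / S + 4 * s * \<bar>\<delta> n\<bar>)"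
          using Rw[OF i] S s by (intro mult_right_mono) auto
        also have "\<dots> = R * a * (2 + 4 * (s * S * \<bar>\<delta> n\<bar>))"
          using S by (simp add: field_simps)
        also have "\<dots> \<le> R * a * (2 + 8 * \<kappa>)"
        proof (rule mult_left_mono)
          show "2 + 4 * (s * S * \<bar>\<delta> n\<bar>) \<le> 2 + 8 * \<kappa>" using sS(2) by linarith
        qed (use a in simp)
        also have "\<dots> \<le> e" by (rule a)
        finally show "\<bar>birkhoff_sum \<alpha> f (N i) x - real (i * w) * birkhoff_sum \<alpha> f (q n) 0\<bar> \<le> e" .
      qed
      then obtain x x' where close:
        "\<And>i. i < R \<Longrightarrow> \<bar>birkhoff_sum \<alpha> f (N i) x' + birkhoff_sum \<alpha> f (- N i) x\<bar> \<le> \<eta>" by blast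
      have "real w * (real w * \<bar>\<delta> n\<bar>) ^ r * (1 / 6) \<le> 2 ^ (r + 1) * \<eta>"
      proof (rule displacement_lower_bound[OF roof q_pos cop \<delta> \<open>odd r\<close> \<open>\<delta> n \<noteq> 0\<close> w(3) _ far])
        have "s * \<bar>\<delta> n\<bar> < 1 / 2"
        proof -
          have "S * (s * \<bar>\<delta> n\<bar>) = s * S * \<bar>\<delta> n\<bar>" by simp
          then have "S * (s * \<bar>\<delta> n\<bar>) < S * (1 / 2)" using sS(2) \<open>4 * \<kappa> < S\<close> by linarith
          then show ?thesis using S(2) by (subst (asm) mult_less_cancel_left_pos) auto
        qed
        moreover have "s * (R * real w * \<bar>\<delta> n\<bar>) \<le> 1 / 2"
        proof -
          have "s * (R * real w * \<bar>\<delta> n\<bar>) \<le> s * (R * (a * S) * \<bar>\<delta> n\<bar>)"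
            using s w by (intro mult_left_mono mult_right_mono) auto
          also have "\<dots> = R * a * (s * S * \<bar>\<delta> n\<bar>)" by (simp add: mult_ac)
          also have "\<dots> \<le> R * a * (2 * \<kappa>)" using sS a by (intro mult_left_mono) auto
          finally show ?thesis using a by linarith
        qed
        ultimately have "s * (R * real w * \<bar>\<delta> n\<bar>) + s * \<bar>\<delta> n\<bar> < 1" by linarith
        then show "of_int (q n) * ((5 * (real (r + 2) * real w) + 1) * \<bar>\<delta> n\<bar>) < 1"
          unfolding s_def R_def by (simp add: algebra_simps)
        fix i assume "i < 5 * (r + 2)"
        then show "\<bar>birkhoff_sum \<alpha> f (int (i * w) * q n) x' + birkhoff_sum \<alpha> f (- (int (i * w) * q n)) x\<bar> \<le> \<eta>"
          using close[of i] by (simp add: R_def N_def)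
      qed
      moreover have "b \<le> real w * (real w * \<bar>\<delta> n\<bar>) ^ r * (1 / 6)"
      proof -
        have "a * \<kappa> / 4 / s \<le> real w * \<bar>\<delta> n\<bar>"
        proof -
          have "a * \<kappa> / 4 \<le> a / 2 * (s * S * \<bar>\<delta> n\<bar>)" using sS a mult_left_mono[of "\<kappa> / 2" "s * S * \<bar>\<delta> n\<bar>" "a / 2"] by simp
          also have "\<dots> = a * S / 2 * \<bar>\<delta> n\<bar> * s" by (simp add: mult_ac)
          also have "\<dots> \<le> real w * \<bar>\<delta> n\<bar> * s" using w s by (intro mult_right_mono) auto
          finally show ?thesis using s by (simp add: field_simps)
        qed
        then have "(a * \<kappa> / 4 / s) ^ r \<le> (real w * \<bar>\<delta> n\<bar>) ^ r"
          using a \<open>0 < \<kappa>\<close> s by (intro power_mono) auto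
        then have "(a * S / 2) * (a * \<kappa> / 4 / s) ^ r \<le> real w * (real w * \<bar>\<delta> n\<bar>) ^ r"
          using w a S \<open>0 < \<kappa>\<close> s by (intro mult_mono) auto
        \<comment> \<open>The factor \<open>S = s ^ r\<close> from \<open>w\<close> cancels the r-th
          power of 1/s exactly.\<close>
        moreover have "(a * S / 2) * (a * \<kappa> / 4 / s) ^ r = (a * \<kappa> / 4) ^ r * (a / 2)"
          using s unfolding S_def power_divide[of _ s] by simp
        ultimately show ?thesis unfolding b_def by linarith
      qed
      moreover have "2 ^ (r + 1) * \<eta> < b" using \<open>0 < b\<close> by (simp add: \<eta>_def)
      ultimately show False by linarith
    qed
  qed
qed

end
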